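(* There is an algorithm which, given any positive integers $n,m$ with $m\le\binom n2$ and any function $f:\{0,1,\dots,m\}\rightarrow\mathbb{R}$, finds, in $O(n^5m^2)$ time, a (simple) graph $G$ on $[n]$ with $m$ edges whose degree sequence $d=(d_1,\dots,d_n)$ maximizes $\sum_{i=1}^n f(d_i)$ over all graphs on $[n]$ with $m$ edges.
   Context: Let $[n]:=\{1,\dots,n\}$. The degree sequence of a simple graph $G=([n],E)$ is the vector $d=(d_1,\dots,d_n)$ with $d_i=|\{e\in E:i\in e\}|$. This is the problem of optimization over degree sequences of $k$-hypergraphs for $k=2$ with identical univariate functions $f_1=\cdots=f_n=f$. The function $f$ is arbitrary and is given by its values (each value $f(t)$ is available in unit time, and arithmetic operations and comparisons are counted as unit-time operations). *)

theory Defs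
  imports Complex_Main
begin

definition simple_graph :: "nat \<Rightarrow> nat set set \<Rightarrow> bool" where
  "simple_graph n E \<longleftrightarrow> (\<forall>e\<in>E. e \<subseteq> {1..n} \<and> card e = 2)"

definition degree :: "nat set set \<Rightarrow> nat \<Rightarrow> nat" where
  "degree E i = card {e \<in> E. i \<in> e}"

definition objective :: "nat \<Rightarrow> (nat \<Rightarrow> real) \<Rightarrow> nat set set \<Rightarrow> real" where
  "objective n f E = (\<Sum>i=1..n. f (degree E i))"

definition optimal_graph :: "nat \<Rightarrow> nat \<Rightarrow> (nat \<Rightarrow> real) \<Rightarrow> nat set set \<Rightarrow> bool" where
  "optimal_graph n m f E \<longleftrightarrow>
     simple_graph n E \<and> card E = m \<and>
     (\<forall>E'. simple_graph n E' \<and> card E' = m \<longrightarrow> objective n f E' \<le> objective n f E)"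

text \<open>
  Algorithms are programs of a structured real RAM with two sorts of memory, natural numbers and
  exact reals, each with scalar variables and with unbounded arrays that are indexed by natural
  numbers. Reals influence the natural-number part only through comparisons: there is no
  rounding and no conversion. Real constants are restricted to integers, since an arbitrary real constant could
  encode an infinite amount of information.
  Every arithmetic operation, comparison, Boolean connective, constant, memory access and control
  step costs one time unit, whatever the size of the numbers involved.
\<close>

type_synonym vname = string

record state =
  nvar :: "vname \<Rightarrow> nat"
  narr :: "vname \<Rightarrow> nat \<Rightarrow> nat"
  rvar :: "vname \<Rightarrow> real"
  rarr :: "vname \<Rightarrow> nat \<Rightarrow> real"

datatype nexp =
    NConst nat
  | NVar vname
  | NArr vname nexp
  | NAdd nexp nexp
  | NSub nexp nexp
  | NMul nexp nexp

datatype rexp =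
    RConst int
  | RVar vname
  | RArr vname nexp
  | RAdd rexp rexp
  | RSub rexp rexp
  | RMul rexp rexp
  | RDiv rexp rexp

datatype bexp =
    NLess nexp nexp
  | NEq nexp nexp
  | RLess rexp rexp
  | REq rexp rexp
  | BNot bexp
  | BAnd bexp bexp

text \<open>
  Subtraction of natural numbers is truncated, and division of a real by zero yields zero,
  as in HOL.
\<close>

primrec nval :: "nexp \<Rightarrow> state \<Rightarrow> nat" where
  "nval (NConst k) s = k"
| "nval (NVar x) s = nvar s x"
| "nval (NArr x a) s = narr s x (nval a s)"
| "nval (NAdd a b) s = nval a s + nval b s"
| "nval (NSub a b) s = nval a s - nval b s"
| "nval (NMul a b) s = nval a s * nval b s"

primrec rval :: "rexp \<Rightarrow> state \<Rightarrow> real" where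
  "rval (RConst k) s = of_int k"
| "rval (RVar x) s = rvar s x"
| "rval (RArr x a) s = rarr s x (nval a s)"
| "rval (RAdd a b) s = rval a s + rval b s"
| "rval (RSub a b) s = rval a s - rval b s"
| "rval (RMul a b) s = rval a s * rval b s"
| "rval (RDiv a b) s = rval a s / rval b s"

primrec bval :: "bexp \<Rightarrow> state \<Rightarrow> bool" where
  "bval (NLess a b) s \<longleftrightarrow> nval a s < nval b s"
| "bval (NEq a b) s \<longleftrightarrow> nval a s = nval b s"
| "bval (RLess a b) s \<longleftrightarrow> rval a s < rval b s"
| "bval (REq a b) s \<longleftrightarrow> rval a s = rval b s"
| "bval (BNot b) s \<longleftrightarrow> \<not> bval b s"
| "bval (BAnd b c) s \<longleftrightarrow> bval b s \<and> bval c s"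

primrec ncost :: "nexp \<Rightarrow> nat" where
  "ncost (NConst k) = 1"
| "ncost (NVar x) = 1"
| "ncost (NArr x a) = 1 + ncost a"
| "ncost (NAdd a b) = 1 + ncost a + ncost b"
| "ncost (NSub a b) = 1 + ncost a + ncost b"
| "ncost (NMul a b) = 1 + ncost a + ncost b"

primrec rcost :: "rexp \<Rightarrow> nat" where
  "rcost (RConst k) = 1"
| "rcost (RVar x) = 1"
| "rcost (RArr x a) = 1 + ncost a"
| "rcost (RAdd a b) = 1 + rcost a + rcost b"
| "rcost (RSub a b) = 1 + rcost a + rcost b"
| "rcost (RMul a b) = 1 + rcost a + rcost b"
| "rcost (RDiv a b) = 1 + rcost a + rcost b"

primrec bcost :: "bexp \<Rightarrow> nat" where
  "bcost (NLess a b) = 1 + ncost a + ncost b"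
| "bcost (NEq a b) = 1 + ncost a + ncost b"
| "bcost (RLess a b) = 1 + rcost a + rcost b"
| "bcost (REq a b) = 1 + rcost a + rcost b"
| "bcost (BNot b) = 1 + bcost b"
| "bcost (BAnd b c) = 1 + bcost b + bcost c"

datatype com =
    Skip
  | NAssign vname nexp
  | NStore vname nexp nexp
  | RAssign vname rexp
  | RStore vname nexp rexp
  | Seq com com
  | If bexp com com
  | While bexp com

text \<open>
  \<open>exec c s t s'\<close>: started in \<open>s\<close>, the program \<open>c\<close> halts after exactly \<open>t\<close> time units in \<open>s'\<close>.
\<close>

inductive exec :: "com \<Rightarrow> state \<Rightarrow> nat \<Rightarrow> state \<Rightarrow> bool" where
  Skip: "exec Skip s 1 s"
| NAssign: "exec (NAssign x a) s (1 + ncost a) (s\<lparr>nvar := (nvar s)(x := nval a s)\<rparr>)"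
| NStore: "exec (NStore x i a) s (1 + ncost i + ncost a)
    (s\<lparr>narr := (narr s)(x := (narr s x)(nval i s := nval a s))\<rparr>)"
| RAssign: "exec (RAssign x a) s (1 + rcost a) (s\<lparr>rvar := (rvar s)(x := rval a s)\<rparr>)"
| RStore: "exec (RStore x i a) s (1 + ncost i + rcost a)
    (s\<lparr>rarr := (rarr s)(x := (rarr s x)(nval i s := rval a s))\<rparr>)"
| Seq: "exec c1 s1 t1 s2 \<Longrightarrow> exec c2 s2 t2 s3 \<Longrightarrow> exec (Seq c1 c2) s1 (t1 + t2) s3"
| IfTrue: "bval b s \<Longrightarrow> exec c1 s t s' \<Longrightarrow> exec (If b c1 c2) s (1 + bcost b + t) s'"
| IfFalse: "\<not> bval b s \<Longrightarrow> exec c2 s t s' \<Longrightarrow> exec (If b c1 c2) s (1 + bcost b + t) s'"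
| WhileFalse: "\<not> bval b s \<Longrightarrow> exec (While b c) s (1 + bcost b) s"
| WhileTrue: "bval b s1 \<Longrightarrow> exec c s1 t1 s2 \<Longrightarrow> exec (While b c) s2 t2 s3 \<Longrightarrow>
    exec (While b c) s1 (1 + bcost b + t1 + t2) s3"

inductive_cases SkipE: "exec Skip s t s'"
inductive_cases NAssignE: "exec (NAssign x a) s t s'"
inductive_cases NStoreE: "exec (NStore x i a) s t s'"
inductive_cases RAssignE: "exec (RAssign x a) s t s'"
inductive_cases RStoreE: "exec (RStore x i a) s t s'"
inductive_cases SeqE: "exec (Seq c1 c2) s t s'"
inductive_cases IfE: "exec (If b c1 c2) s t s'"
inductive_cases WhileE: "exec (While b c) s t s'"

text \<open>
  Execution is deterministic, so exhibiting one halting run bounds the time of the only run.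
\<close>

lemma exec_deterministic:
  "exec c s t s' \<Longrightarrow> exec c s u s'' \<Longrightarrow> u = t \<and> s'' = s'"
proof (induction arbitrary: u s'' rule: exec.induct)
  case Skip then show ?case by (auto elim: SkipE)
next
  case NAssign then show ?case by (auto elim: NAssignE)
next
  case NStore then show ?case by (auto elim: NStoreE)
next
  case RAssign then show ?case by (auto elim: RAssignE)
next
  case RStore then show ?case by (auto elim: RStoreE)
next
  case Seq
  from Seq.prems show ?case by (rule SeqE) (auto dest: Seq.IH)
next
  case IfTrue
  from IfTrue.prems show ?case by (rule IfE) (auto dest: IfTrue.IH simp: IfTrue.hyps)
next
  case IfFalse
  from IfFalse.prems show ?case by (rule IfE) (auto dest: IfFalse.IH simp: IfFalse.hyps)
next
  case WhileFalse
  from WhileFalse.prems show ?case by (rule WhileE) (auto simp: WhileFalse.hyps)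
next
  case WhileTrue
  from WhileTrue.prems show ?case by (rule WhileE) (auto dest: WhileTrue.IH simp: WhileTrue.hyps)
qed

text \<open>
  The instance is placed in the variables \<open>n\<close>, \<open>m\<close> and the real array \<open>f\<close>. The table holds the values
  of \<open>f\<close> on \<open>{0..m}\<close> only, so a program cannot see \<open>f\<close> outside that set; all other cells are zero.
\<close>

definition input_state :: "nat \<Rightarrow> nat \<Rightarrow> (nat \<Rightarrow> real) \<Rightarrow> state" where
  "input_state n m f =
     \<lparr>nvar = (\<lambda>_. 0)(''n'' := n, ''m'' := m),
      narr = (\<lambda>_ _. 0),
      rvar = (\<lambda>_. 0),
      rarr = (\<lambda>_ _. 0)(''f'' := (\<lambda>t. if t \<le> m then f t else 0))\<rparr>"

text \<open>
  A graph with \<open>m\<close> edges is returned as an edge list: the end points of the \<open>k\<close>-th edge are the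
  \<open>k\<close>-th entries of the arrays \<open>u\<close> and \<open>v\<close>.
\<close>

definition output_graph :: "nat \<Rightarrow> state \<Rightarrow> nat set set" where
  "output_graph m s = {{narr s ''u'' k, narr s ''v'' k} | k. k < m}"

end

theory Submission
  imports Defs
begin

text \<open>
  The objective depends only on the sorted degree sequence, so the problem is to optimize
  \<open>(\<Sum>i=1..n. f (d i))\<close> over the nonincreasing sequences \<open>d\<close> that occur, and to find a graph for an
  optimal one.

  Among the nonincreasing sequences with the sum \<open>2 * m\<close>, those that occur are described by the
  Erdos-Gallai condition, written as
  \<open>(\<Sum>i=1..k. d i) + k \<le> (\<Sum>j=1..n. min (d j) k)\<close> for all \<open>k \<le> d k\<close>. The right-hand side is the sum of
  the first \<open>k\<close> terms of the conjugate of \<open>d\<close>. When a sequence is read from both ends, large entries on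
  the left and small ones on the right, one term of \<open>d\<close> and one of its conjugate become known at the same
  time. The condition can then be checked in passing with two running sums, and the future of a partially
  read sequence depends only on the number \<open>k\<close> of entries read on the left, an upper bound \<open>a\<close> for
  the unread entries, the position \<open>b\<close> on the right and the two sums. This gives a table of \<open>O(n ^ 3 * m ^ 2)\<close> cells with constant
  work for each (\<open>completion\<close>, \<open>best\<close>).

  Necessity of the condition is the usual count of the edges at a set of vertices (\<open>degree_sum_bound\<close>).
  Sufficiency is proved by the construction that the program carries out. Among the pairs \<open>x < y\<close> with
  \<open>x \<le> d y\<close>, the lexicographically first \<open>m\<close> form a graph whose degrees have prefix sums at least as
  large as those of \<open>d\<close> (\<open>staircase_dominates\<close>). An edge \<open>{i, w}\<close> can be turned into \<open>{j, w}\<close> whenever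
  \<open>i\<close> has more neighbours than \<open>j\<close> and \<open>w\<close> is suitably chosen. One pass over all triples \<open>(j, i, w)\<close>
  with \<open>i < j\<close>, moving surplus degree from \<open>i\<close> to \<open>j\<close>, removes all deficits from left to right
  (\<open>transfer_row_end\<close>, \<open>transfer_col_end\<close>). Since both sequences have the sum \<open>2 * m\<close>, the degrees are
  then equal to \<open>d\<close>.

  The program fills the table, follows the stored moves to obtain \<open>d\<close>, builds the graph in an adjacency
  matrix, makes the transfers and lists the edges. It takes \<open>O(n ^ 3 * m ^ 2)\<close> time for
  the table and \<open>O(n ^ 3)\<close> for the rest, which is within \<open>O(n ^ 5 * m ^ 2)\<close>.
\<close>

section \<open>Graphs, degrees and neighbours\<close>

lemma simple_graph_finite:
  assumes "simple_graph n E" shows "finite E"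
proof -
  have "E \<subseteq> Pow {1..n}" using assms by (auto simp: simple_graph_def)
  then show ?thesis by (rule finite_subset) simp
qed

lemma simple_graph_edge:
  assumes "simple_graph n E" "{x, y} \<in> E"
  shows "x \<noteq> y" "1 \<le> x" "x \<le> n" "1 \<le> y" "y \<le> n"
  using assms by (auto simp: simple_graph_def dest!: bspec)

lemma simple_graph_edge_ex:
  assumes "simple_graph n E" "e \<in> E"
  obtains x y where "e = {x, y}" "x < y" "1 \<le> x" "y \<le> n"
proof -
  from assms have "e \<subseteq> {1..n}" "card e = 2" by (auto simp: simple_graph_def)
  then obtain x y where e: "e = {x, y}" "x \<noteq> y" by (auto simp: card_2_iff)
  show ?thesis
  proof (cases "x < y")
    case True then show ?thesis using e \<open>e \<subseteq> {1..n}\<close> that by auto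
  next
    case False
    then show ?thesis using e \<open>e \<subseteq> {1..n}\<close> that[of y x] by (auto simp: insert_commute)
  qed
qed

lemma degree_neighbours:
  assumes "simple_graph n E"
  shows "degree E v = card {u \<in> {1..n}. {u, v} \<in> E}"
proof -
  have "bij_betw (\<lambda>u. {u, v}) {u \<in> {1..n}. {u, v} \<in> E} {e \<in> E. v \<in> e}"
  proof (rule bij_betwI')
    fix x y assume "x \<in> {u \<in> {1..n}. {u, v} \<in> E}" "y \<in> {u \<in> {1..n}. {u, v} \<in> E}"
    then show "({x, v} = {y, v}) = (x = y)" by (auto simp: doubleton_eq_iff)
  next
    fix x assume "x \<in> {u \<in> {1..n}. {u, v} \<in> E}"
    then show "{x, v} \<in> {e \<in> E. v \<in> e}" by auto
  next
    fix e assume e: "e \<in> {e \<in> E. v \<in> e}"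
    then obtain x y where xy: "e = {x, y}" "x < y" "1 \<le> x" "y \<le> n"
      using simple_graph_edge_ex[OF assms] by blast
    show "\<exists>x\<in>{u \<in> {1..n}. {u, v} \<in> E}. e = {x, v}"
    proof (cases "v = x")
      case True then show ?thesis using e xy by (intro bexI[of _ y]) (auto simp: insert_commute)
    next
      case False then have "v = y" using e xy by auto
      then show ?thesis using e xy by (intro bexI[of _ x]) auto
    qed
  qed
  then show ?thesis unfolding degree_def by (simp add: bij_betw_same_card)
qed

lemma handshake:
  assumes "simple_graph n E"
  shows "(\<Sum>i=1..n. degree E i) = 2 * card E"
  unfolding degree_def
proof (rule sum_multicount)
  show "\<forall>e\<in>E. card {i \<in> {1..n}. i \<in> e} = 2"
  proof
    fix e assume "e \<in> E"
    then have "e \<subseteq> {1..n}" "card e = 2" using assms by (auto simp: simple_graph_def)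
    moreover from this have "{i \<in> {1..n}. i \<in> e} = e" by auto
    ultimately show "card {i \<in> {1..n}. i \<in> e} = 2" by simp
  qed
qed (use simple_graph_finite[OF assms] in auto)

lemma degree_le_card:
  assumes "finite E" shows "degree E i \<le> card E"
  unfolding degree_def using assms by (intro card_mono) auto

lemma degree_insert:
  assumes "finite E" "e \<notin> E"
  shows "degree (insert e E) l = degree E l + of_bool (l \<in> e)"
proof -
  have "{x \<in> insert e E. l \<in> x} = (if l \<in> e then insert e {x \<in> E. l \<in> x} else {x \<in> E. l \<in> x})"
    by auto
  then show ?thesis using assms by (simp add: degree_def)
qed

text \<open>
  Both sides count the cells in the first \<open>k\<close> columns of the diagram whose rows have the lengths \<open>d y\<close>.
\<close>

lemma sum_card_ge_eq_sum_min:
  "(\<Sum>i=1..k. card {y \<in> {1..n}. i \<le> d y}) = (\<Sum>y=1..n::nat. min (d y) (k::nat))"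
proof (rule sum_multicount_gen)
  show "\<forall>y\<in>{1..n}. card {i \<in> {1..k}. i \<le> d y} = min (d y) k"
  proof
    fix y
    have "{i \<in> {1..k}. i \<le> d y} = {1..min (d y) k}" by auto
    then show "card {i \<in> {1..k}. i \<le> d y} = min (d y) k" by simp
  qed
qed simp_all

lemma sum_split_at:
  fixes h :: "nat \<Rightarrow> nat"
  assumes "k \<le> n"
  shows "(\<Sum>i=1..n. h i) = (\<Sum>i=1..k. h i) + (\<Sum>i=Suc k..n. h i)"
  using assms sum.ub_add_nat[of 1 k h "n - k"] by simp

section \<open>The Erdos-Gallai condition\<close>

definition nonincreasing :: "nat \<Rightarrow> (nat \<Rightarrow> nat) \<Rightarrow> bool" where
  "nonincreasing n d \<longleftrightarrow> (\<forall>i j. 1 \<le> i \<longrightarrow> i \<le> j \<longrightarrow> j \<le> n \<longrightarrow> d j \<le> d i)"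

text \<open>
  The index \<open>k\<close> ranges only over the Durfee square, that is \<open>k \<le> d k\<close>. There the first \<open>k\<close> terms of
  the right-hand side are equal to \<open>k\<close>, so that the inequality is the usual
  \<open>d 1 + \<dots> + d k \<le> k * (k - 1) + (\<Sum>j=k+1..n. min (d j) k)\<close>. The form chosen here is the one that the
  dynamic program can follow: by \<open>sum_card_ge_eq_sum_min\<close>, its right-hand side is the sum of the first
  \<open>k\<close> terms of the conjugate of \<open>d\<close>.
\<close>

definition erdos_gallai :: "nat \<Rightarrow> nat \<Rightarrow> (nat \<Rightarrow> nat) \<Rightarrow> bool" where
  "erdos_gallai n m d \<longleftrightarrow> nonincreasing n d \<and> (\<Sum>i=1..n. d i) = 2 * m \<and>
     (\<forall>k\<in>{1..n}. k \<le> d k \<longrightarrow> (\<Sum>i=1..k. d i) + k \<le> (\<Sum>j=1..n. min (d j) k))"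

text \<open>
  Count the adjacent pairs \<open>(u, v)\<close> with \<open>v \<in> A\<close> by their first component. A vertex \<open>u\<close> outside \<open>A\<close> has at
  most \<open>min (degree E u) (card A)\<close> partners, and a vertex of \<open>A\<close> has at most \<open>card A - 1\<close>, because it is
  not its own neighbour. The second summand on the left makes up for these missing ones.
\<close>

lemma degree_sum_bound:
  assumes G: "simple_graph n E" and A: "A \<subseteq> {1..n}" and big: "\<And>v. v \<in> A \<Longrightarrow> card A \<le> degree E v"
  shows "(\<Sum>v\<in>A. degree E v) + card A \<le> (\<Sum>u=1..n. min (degree E u) (card A))"
proof -
  have fA: "finite A" using A by (rule finite_subset) simp
  have "(\<Sum>v\<in>A. degree E v) = (\<Sum>v\<in>A. card {u \<in> {1..n}. {u, v} \<in> E})"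
    by (simp add: degree_neighbours[OF G])
  also have "\<dots> = (\<Sum>u=1..n. card {v \<in> A. {u, v} \<in> E})"
    by (rule sum_multicount_gen) (use fA in auto)
  finally have count: "(\<Sum>v\<in>A. degree E v) = (\<Sum>u=1..n. card {v \<in> A. {u, v} \<in> E})" .
  have "(\<Sum>u=1..n. of_bool (u \<in> A)) = card A"
    using A by (simp add: Int_absorb1 of_bool_def sum.If_cases)
  then have "(\<Sum>v\<in>A. degree E v) + card A = (\<Sum>u=1..n. card {v \<in> A. {u, v} \<in> E} + of_bool (u \<in> A))"
    by (simp add: count sum.distrib)
  also have "\<dots> \<le> (\<Sum>u=1..n. min (degree E u) (card A))"
  proof (rule sum_mono)
    fix u assume u: "u \<in> {1..n}"
    show "card {v \<in> A. {u, v} \<in> E} + of_bool (u \<in> A) \<le> min (degree E u) (card A)"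
    proof (cases "u \<in> A")
      case True
      have "{v \<in> A. {u, v} \<in> E} \<subseteq> A - {u}" using simple_graph_edge(1)[OF G] by blast
      then have "card {v \<in> A. {u, v} \<in> E} \<le> card (A - {u})" using fA by (intro card_mono) auto
      then have "card {v \<in> A. {u, v} \<in> E} + 1 \<le> card A"
        using True fA by (metis Suc_eq_plus1 card_Suc_Diff1 Suc_le_mono)
      then show ?thesis using True big[OF True] by simp
    next
      case False
      have "card {v \<in> A. {u, v} \<in> E} \<le> card {v \<in> {1..n}. {v, u} \<in> E}"
        using A by (intro card_mono) (auto simp: insert_commute)
      moreover have "card {v \<in> A. {u, v} \<in> E} \<le> card A" using fA by (intro card_mono) auto
      ultimately show ?thesis using False by (simp add: degree_neighbours[OF G])
    qed
  qed
  finally show ?thesis .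
qed

lemma sorting_bijection:
  fixes h :: "nat \<Rightarrow> nat"
  obtains \<pi> where "bij_betw \<pi> {1..n} {1..n}" "nonincreasing n (h \<circ> \<pi>)"
proof -
  define xs where "xs = sort_key (\<lambda>i. - int (h i)) [1..<Suc n]"
  have len: "length xs = n" and dist: "distinct xs" and set: "set xs = {1..n}"
    by (auto simp: xs_def)
  have srt: "sorted (map (\<lambda>i. - int (h i)) xs)" by (simp add: xs_def)
  define \<pi> where "\<pi> i = xs ! (i - 1)" for i
  have "bij_betw (\<lambda>i. xs ! i) {..<n} {1..n}" using bij_betw_nth[OF dist] len set by auto
  moreover have "bij_betw (\<lambda>i. i - 1) {1..n} {..<n}"
    by (rule bij_betw_byWitness[where f' = Suc]) auto
  ultimately have "bij_betw ((\<lambda>i. xs ! i) \<circ> (\<lambda>i. i - 1)) {1..n} {1..n}"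
    by (metis bij_betw_trans)
  then have "bij_betw \<pi> {1..n} {1..n}" by (simp add: \<pi>_def[abs_def] comp_def)
  moreover have "nonincreasing n (h \<circ> \<pi>)"
    unfolding nonincreasing_def
  proof (intro allI impI)
    fix i j assume "1 \<le> i" "i \<le> j" "j \<le> n"
    then have "map (\<lambda>i. - int (h i)) xs ! (i - 1) \<le> map (\<lambda>i. - int (h i)) xs ! (j - 1)"
      using srt len by (intro sorted_nth_mono) auto
    then show "(h \<circ> \<pi>) j \<le> (h \<circ> \<pi>) i" using \<open>1 \<le> i\<close> \<open>i \<le> j\<close> \<open>j \<le> n\<close> len by (auto simp: \<pi>_def)
  qed
  ultimately show ?thesis by (rule that)
qed

text \<open>
  All vertices carry the same function, so the objective only depends on the multiset of degrees and the
  degrees may be sorted.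
\<close>

lemma graph_erdos_gallai:
  assumes G: "simple_graph n E" "card E = m"
  obtains d where "erdos_gallai n m d" "\<And>f. objective n f E = (\<Sum>i=1..n. f (d i))"
proof -
  obtain \<pi> where bij: "bij_betw \<pi> {1..n} {1..n}" and mono: "nonincreasing n (degree E \<circ> \<pi>)"
    by (rule sorting_bijection)
  define d where "d = degree E \<circ> \<pi>"
  have reindex: "(\<Sum>i=1..n. g (d i)) = (\<Sum>i=1..n. g (degree E i))" for g :: "nat \<Rightarrow> 'a :: comm_monoid_add"
    using sum.reindex_bij_betw[OF bij, of "\<lambda>i. g (degree E i)"] by (simp add: d_def)
  have "(\<Sum>i=1..k. d i) + k \<le> (\<Sum>j=1..n. min (d j) k)" if k: "k \<in> {1..n}" "k \<le> d k" for k
  proof -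
    have inj: "inj_on \<pi> {1..k}" using bij k by (auto simp: bij_betw_def intro: inj_on_subset)
    have sub: "\<pi> ` {1..k} \<subseteq> {1..n}" using bij k by (auto simp: bij_betw_def)
    have card: "card (\<pi> ` {1..k}) = k" using inj by (simp add: card_image)
    have "(\<Sum>v\<in>\<pi> ` {1..k}. degree E v) + card (\<pi> ` {1..k})
        \<le> (\<Sum>u=1..n. min (degree E u) (card (\<pi> ` {1..k})))"
    proof (rule degree_sum_bound[OF G(1) sub])
      fix v assume "v \<in> \<pi> ` {1..k}"
      then obtain i where "v = \<pi> i" "1 \<le> i" "i \<le> k" by auto
      then have "d k \<le> degree E v" using mono k by (auto simp: nonincreasing_def d_def)
      then show "card (\<pi> ` {1..k}) \<le> degree E v" using k card by simp
    qed
    moreover have "(\<Sum>v\<in>\<pi> ` {1..k}. degree E v) = (\<Sum>i=1..k. d i)"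
      using inj by (simp add: sum.reindex d_def)
    ultimately show ?thesis unfolding card reindex[of "\<lambda>t. min t k"] by simp
  qed
  moreover have "(\<Sum>i=1..n. d i) = 2 * m" using reindex[of "\<lambda>t. t"] handshake[OF G(1)] G(2) by simp
  ultimately have "erdos_gallai n m d" using mono by (auto simp: erdos_gallai_def d_def)
  then show ?thesis by (rule that) (simp only: objective_def reindex)
qed

section \<open>A graph whose degrees dominate a given sequence\<close>

text \<open>
  The pairs \<open>x < y\<close> with \<open>x \<le> d y\<close>, listed lexicographically, cut off in front of the pair \<open>(i, j)\<close>. For a
  nonincreasing \<open>d\<close> the partners of \<open>x\<close> form an interval that ends at the \<open>x\<close>-th term of the conjugate of
  \<open>d\<close>. This concentrates the edges on the small vertices, so that the prefix sums of the degrees are large.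
\<close>

definition staircase :: "nat \<Rightarrow> (nat \<Rightarrow> nat) \<Rightarrow> nat \<Rightarrow> nat \<Rightarrow> nat set set" where
  "staircase n d i j =
     {{x, y} |x y. 1 \<le> x \<and> x < y \<and> y \<le> n \<and> x \<le> d y \<and> (x < i \<or> x = i \<and> y < j)}"

lemma staircase_edge:
  assumes "x < y"
  shows "{x, y} \<in> staircase n d i j \<longleftrightarrow>
    1 \<le> x \<and> y \<le> n \<and> x \<le> d y \<and> (x < i \<or> x = i \<and> y < j)"
  using assms by (auto simp: staircase_def doubleton_eq_iff)

lemma staircase_simple: "simple_graph n (staircase n d i j)"
  by (auto simp: staircase_def simple_graph_def)

text \<open>
  If the rows \<open>1, \<dots>, k\<close> of the staircase are complete and \<open>k\<close> lies in the Durfee square, then every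
  \<open>i \<le> k\<close> is adjacent to all \<open>y \<noteq> i\<close> with \<open>i \<le> d y\<close>. Summed over \<open>i \<le> k\<close>, these degrees are the
  right-hand side of the Erdos-Gallai inequality minus \<open>k\<close>.
\<close>

lemma staircase_prefix_complete:
  assumes eg: "erdos_gallai n m d" and k: "1 \<le> k" "k \<le> n" "k \<le> d k" "k < i0"
  shows "(\<Sum>i=1..k. d i) \<le> (\<Sum>i=1..k. degree (staircase n d i0 j0) i)"
proof -
  let ?E = "staircase n d i0 j0"
  have mono: "d j \<le> d i" if "1 \<le> i" "i \<le> j" "j \<le> n" for i j
    using eg that by (auto simp: erdos_gallai_def nonincreasing_def)
  have deg: "card {y \<in> {1..n}. i \<le> d y} \<le> degree ?E i + 1" if i: "i \<in> {1..k}" for i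
  proof -
    have "{y \<in> {1..n}. i \<le> d y} - {i} \<subseteq> {u \<in> {1..n}. {u, i} \<in> ?E}"
    proof
      fix y assume y: "y \<in> {y \<in> {1..n}. i \<le> d y} - {i}"
      show "y \<in> {u \<in> {1..n}. {u, i} \<in> ?E}"
      proof (cases "i < y")
        case True
        then show ?thesis using y i k staircase_edge[OF True] by (simp add: insert_commute)
      next
        case False
        then have "y < i" using y by auto
        moreover have "d k \<le> d i" using i k by (intro mono) auto
        ultimately show ?thesis using y i k by (simp add: staircase_edge)
      qed
    qed
    then have "card ({y \<in> {1..n}. i \<le> d y} - {i}) \<le> degree ?E i"
      unfolding degree_neighbours[OF staircase_simple] by (intro card_mono) auto
    then show ?thesis by (simp add: card_Diff_singleton_if split: if_splits)
  qed
  have "(\<Sum>i=1..k. d i) + k \<le> (\<Sum>j=1..n. min (d j) k)" using eg k by (simp add: erdos_gallai_def)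
  also have "\<dots> = (\<Sum>i=1..k. card {y \<in> {1..n}. i \<le> d y})" by (rule sum_card_ge_eq_sum_min[symmetric])
  also have "\<dots> \<le> (\<Sum>i=1..k. degree ?E i + 1)" using deg by (rule sum_mono)
  also have "\<dots> = (\<Sum>i=1..k. degree ?E i) + k" by (simp only: sum.distrib) simp
  finally show ?thesis by simp
qed

text \<open>
  For \<open>k > 0\<close>, either the first \<open>k\<close> rows are complete inside the Durfee square, which is the previous lemma, or no edge
  has both ends above \<open>k\<close>. In the second case a vertex \<open>j > k\<close> only has neighbours \<open>u < j\<close> with
  \<open>u \<le> d j\<close>, hence at most \<open>d j\<close> of them. As the total is the same for the graph and for \<open>d\<close>, smaller
  sums over the tail mean larger prefix sums.
\<close>

lemma staircase_dominates:
  assumes eg: "erdos_gallai n m d" and card: "card (staircase n d i0 j0) = m" and k: "k \<le> n"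
  shows "(\<Sum>i=1..k. d i) \<le> (\<Sum>i=1..k. degree (staircase n d i0 j0) i)"
proof (cases "1 \<le> k \<and> k \<le> d k \<and> k < i0")
  case True
  then show ?thesis using staircase_prefix_complete[OF eg] k by auto
next
  case False
  let ?E = "staircase n d i0 j0"
  have mono: "d j \<le> d i" if "1 \<le> i" "i \<le> j" "j \<le> n" for i j
    using eg that by (auto simp: erdos_gallai_def nonincreasing_def)
  show ?thesis
  proof (cases "k = 0")
    case nz: False
    have low: "x \<le> k" if "x < y" "{x, y} \<in> ?E" for x y
    proof (rule ccontr)
      assume "\<not> x \<le> k"
      moreover have *: "1 \<le> x" "y \<le> n" "x \<le> d y" "x \<le> i0" using that by (auto simp: staircase_edge)
      moreover have "d y \<le> d k" using \<open>\<not> x \<le> k\<close> * that(1) nz by (intro mono) auto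
      ultimately show False using \<open>\<not> (1 \<le> k \<and> k \<le> d k \<and> k < i0)\<close> nz by linarith
    qed
    have "(\<Sum>j=Suc k..n. degree ?E j) \<le> (\<Sum>j=Suc k..n. d j)"
    proof (rule sum_mono)
      fix j assume j: "j \<in> {Suc k..n}"
      have "{u \<in> {1..n}. {u, j} \<in> ?E} \<subseteq> {1..d j}"
      proof
        fix u assume u: "u \<in> {u \<in> {1..n}. {u, j} \<in> ?E}"
        have "u \<noteq> j" using u simple_graph_edge(1)[OF staircase_simple] by blast
        have "\<not> j < u"
        proof
          assume "j < u"
          then have "j \<le> k" using u low by (auto simp: insert_commute)
          then show False using j by simp
        qed
        then have "u < j" using \<open>u \<noteq> j\<close> by simp
        then show "u \<in> {1..d j}" using u by (simp add: staircase_edge)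
      qed
      then have "card {u \<in> {1..n}. {u, j} \<in> ?E} \<le> card {1..d j}" by (intro card_mono) auto
      then show "degree ?E j \<le> d j" by (simp add: degree_neighbours[OF staircase_simple])
    qed
    moreover have "(\<Sum>i=1..n. degree ?E i) = 2 * m" using handshake[OF staircase_simple] card by simp
    moreover have "(\<Sum>i=1..n. d i) = 2 * m" using eg by (simp add: erdos_gallai_def)
    ultimately show ?thesis
      using sum_split_at[OF k, of d] sum_split_at[OF k, of "degree ?E"] by simp
  qed simp
qed

text \<open>
  Twice the number of edges is the sum of the degrees. Let \<open>r\<close> be the side of the Durfee square. The degrees
  of the first \<open>r\<close> vertices add up to enough by \<open>staircase_prefix_complete\<close>, and every later vertex \<open>i\<close> has
  \<open>d i < i\<close> and is therefore adjacent to all of \<open>1, \<dots>, d i\<close>.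
\<close>

lemma staircase_large:
  assumes eg: "erdos_gallai n m d"
  shows "m \<le> card (staircase n d (Suc n) j)"
proof -
  let ?E = "staircase n d (Suc n) j"
  have mono: "d j \<le> d i" if "1 \<le> i" "i \<le> j" "j \<le> n" for i j
    using eg that by (auto simp: erdos_gallai_def nonincreasing_def)
  define R where "R = {k \<in> {1..n}. k \<le> d k}"
  define r where "r = Max (insert 0 R)"
  have fin: "finite (insert 0 R)" by (auto simp: R_def)
  have "r \<in> insert 0 R" unfolding r_def using fin by (intro Max_in) auto
  then have r: "r \<le> n" "r = 0 \<or> 1 \<le> r \<and> r \<le> d r" by (auto simp: R_def)
  have above: "d i < i" if "r < i" "i \<le> n" for i
  proof (rule ccontr)
    assume "\<not> d i < i"
    then have "i \<in> R" using that by (auto simp: R_def)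
    then have "i \<le> r" unfolding r_def using fin by (intro Max_ge) auto
    then show False using that by simp
  qed
  have "(\<Sum>i=1..r. d i) \<le> (\<Sum>i=1..r. degree ?E i)"
  proof (cases "r = 0")
    case False then show ?thesis using r by (intro staircase_prefix_complete[OF eg]) auto
  qed simp
  moreover have "(\<Sum>i=Suc r..n. d i) \<le> (\<Sum>i=Suc r..n. degree ?E i)"
  proof (rule sum_mono)
    fix i assume i: "i \<in> {Suc r..n}"
    have "{1..d i} \<subseteq> {u \<in> {1..n}. {u, i} \<in> ?E}"
      using above[of i] i by (auto simp: staircase_edge)
    then have "card {1..d i} \<le> degree ?E i"
      unfolding degree_neighbours[OF staircase_simple] by (intro card_mono) auto
    then show "d i \<le> degree ?E i" by simp
  qed
  moreover have "(\<Sum>i=1..n. d i) = 2 * m" using eg by (simp add: erdos_gallai_def)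
  ultimately show ?thesis
    using handshake[OF staircase_simple, of n d "Suc n" j]
      sum_split_at[OF r(1), of d] sum_split_at[OF r(1), of "degree ?E"] by simp
qed

section \<open>Unit transfers\<close>

text \<open>
  Replacing the edge \<open>{i, w}\<close> by \<open>{j, w}\<close> moves one unit of degree from \<open>i\<close> to \<open>j\<close> and leaves all other
  degrees unchanged.
\<close>

definition move_edge :: "nat \<Rightarrow> nat \<Rightarrow> nat \<Rightarrow> nat set set \<Rightarrow> nat set set" where
  "move_edge i j w E = insert {j, w} (E - {{i, w}})"

definition movable :: "nat \<Rightarrow> nat \<Rightarrow> nat \<Rightarrow> nat set set \<Rightarrow> bool" where
  "movable i j w E \<longleftrightarrow> {i, w} \<in> E \<and> w \<noteq> j \<and> {j, w} \<notin> E"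

lemma move_edge:
  assumes G: "simple_graph n E" and j: "1 \<le> j" "j \<le> n" and ij: "i \<noteq> j" and mv: "movable i j w E"
  shows "simple_graph n (move_edge i j w E)" "card (move_edge i j w E) = card E"
    and "degree (move_edge i j w E) l + of_bool (l = i) = degree E l + of_bool (l = j)"
proof -
  have w: "i \<noteq> w" "1 \<le> w" "w \<le> n" "w \<noteq> j"
    using simple_graph_edge[OF G, of i w] mv by (auto simp: movable_def)
  have fin: "finite E" by (rule simple_graph_finite[OF G])
  show "simple_graph n (move_edge i j w E)"
    using G j w by (auto simp: simple_graph_def move_edge_def)
  have "0 < card E" using mv fin by (auto simp: movable_def card_gt_0_iff)
  then show "card (move_edge i j w E) = card E"
    using mv fin by (auto simp: move_edge_def movable_def card_insert_if card_Diff_singleton_if)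
  have E: "insert {i, w} (E - {{i, w}}) = E" using mv by (auto simp: movable_def)
  have "degree (insert {i, w} (E - {{i, w}})) l = degree (E - {{i, w}}) l + of_bool (l \<in> {i, w})"
    using fin by (intro degree_insert) auto
  moreover have "degree (move_edge i j w E) l = degree (E - {{i, w}}) l + of_bool (l \<in> {j, w})"
    unfolding move_edge_def using fin mv by (intro degree_insert) (auto simp: movable_def)
  ultimately show "degree (move_edge i j w E) l + of_bool (l = i) = degree E l + of_bool (l = j)"
    unfolding E using w ij by (auto simp: of_bool_def)
qed

text \<open>
  If every neighbour of \<open>i\<close> other than \<open>j\<close> were a neighbour of \<open>j\<close>, then \<open>j\<close> would have at least as many
  neighbours as \<open>i\<close>: adjacency of \<open>i\<close> and \<open>j\<close> counts once for either of them.
\<close>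

lemma movable_exists:
  assumes G: "simple_graph n E" and deg: "degree E j < degree E i"
  obtains w where "w \<le> n" "movable i j w E"
proof (rule ccontr)
  assume contra: "\<not> thesis"
  let ?N = "\<lambda>v. {u \<in> {1..n}. {u, v} \<in> E}"
  have sub: "?N i - {j} \<subseteq> ?N j - {i}"
  proof
    fix u assume u: "u \<in> ?N i - {j}"
    then have "{j, u} \<in> E" using contra that[of u] by (auto simp: movable_def insert_commute)
    moreover have "u \<noteq> i" using u simple_graph_edge(1)[OF G, of u i] by auto
    ultimately show "u \<in> ?N j - {i}" using u by (auto simp: insert_commute)
  qed
  have iff: "j \<in> ?N i \<longleftrightarrow> i \<in> ?N j"
    using simple_graph_edge[OF G, of i j] simple_graph_edge[OF G, of j i] by (auto simp: insert_commute)
  have "card (?N i - {j}) \<le> card (?N j - {i})" using sub by (intro card_mono) auto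
  moreover have "j \<in> ?N i \<Longrightarrow> 0 < card (?N i)" "i \<in> ?N j \<Longrightarrow> 0 < card (?N j)"
    by (auto simp: card_gt_0_iff)
  ultimately have "card (?N i) \<le> card (?N j)"
    using iff by (auto simp: card_Diff_singleton_if split: if_splits)
  then show False using deg by (simp add: degree_neighbours[OF G])
qed

text \<open>
  The transfers are made in a single pass over the triples \<open>(j, i, w)\<close>, in lexicographic order. The three
  invariants hold when the pass reaches \<open>j\<close>, \<open>(j, i)\<close> and \<open>(j, i, w)\<close>. Vertices in front of \<open>j\<close>
  have no deficit any more, and from \<open>j\<close> on the prefix sums of the degrees are at least those of \<open>d\<close>.
  While \<open>j\<close> is served, a donor \<open>l\<close> that has been passed is either exhausted, or \<open>j\<close> is saturated.
\<close>

definition col_inv :: "nat \<Rightarrow> nat \<Rightarrow> (nat \<Rightarrow> nat) \<Rightarrow> nat \<Rightarrow> nat set set \<Rightarrow> bool" where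
  "col_inv n m d j E \<longleftrightarrow> simple_graph n E \<and> card E = m \<and>
     (\<forall>l\<in>{1..n}. l < j \<longrightarrow> d l \<le> degree E l) \<and>
     (\<forall>k\<in>{j..n}. (\<Sum>l=1..k. d l) \<le> (\<Sum>l=1..k. degree E l))"

definition row_inv :: "nat \<Rightarrow> nat \<Rightarrow> (nat \<Rightarrow> nat) \<Rightarrow> nat \<Rightarrow> nat \<Rightarrow> nat set set \<Rightarrow> bool" where
  "row_inv n m d j i E \<longleftrightarrow> col_inv n m d j E \<and>
     (\<forall>l. 1 \<le> l \<and> l < i \<and> l < j \<longrightarrow> degree E l \<le> d l \<or> d j \<le> degree E j)"

definition cell_inv :: "nat \<Rightarrow> nat \<Rightarrow> (nat \<Rightarrow> nat) \<Rightarrow> nat \<Rightarrow> nat \<Rightarrow> nat \<Rightarrow> nat set set \<Rightarrow> bool" where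
  "cell_inv n m d j i w E \<longleftrightarrow> row_inv n m d j i E \<and>
     (i < j \<longrightarrow> degree E i \<le> d i \<or> d j \<le> degree E j \<or> (\<forall>v<w. \<not> movable i j v E))"

definition transfer_step :: "(nat \<Rightarrow> nat) \<Rightarrow> nat \<Rightarrow> nat \<Rightarrow> nat \<Rightarrow> nat set set \<Rightarrow> nat set set" where
  "transfer_step d j i w E =
     (if i < j \<and> degree E j < d j \<and> d i < degree E i \<and> movable i j w E then move_edge i j w E else E)"

text \<open>
  A transfer from \<open>i\<close> to \<open>j\<close> with \<open>i < j\<close> does not change a prefix sum that includes both. It cannot make
  an earlier \<open>w\<close> movable either, since it only removes the edge \<open>{i, w}\<close> and only adds \<open>{j, w}\<close>.
\<close>

lemma transfer_step_inv:
  assumes inv: "cell_inv n m d j i w E" and j: "j \<le> n"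
  shows "cell_inv n m d j i (Suc w) (transfer_step d j i w E)"
proof (cases "i < j \<and> degree E j < d j \<and> d i < degree E i \<and> movable i j w E")
  case False
  then have "transfer_step d j i w E = E" by (auto simp: transfer_step_def)
  then show ?thesis using inv False by (auto simp: cell_inv_def less_Suc_eq)
next
  case True
  then have ij: "i < j" by simp
  let ?E = "move_edge i j w E"
  have E: "transfer_step d j i w E = ?E" using True ij by (simp add: transfer_step_def)
  have G: "simple_graph n E" using inv by (auto simp: cell_inv_def row_inv_def col_inv_def)
  have iw: "1 \<le> i" using simple_graph_edge[OF G] True by (auto simp: movable_def)
  have mvw: "movable i j w E" and j1: "1 \<le> j" and ne: "i \<noteq> j" using True ij by auto
  note mv = move_edge[OF G j1 j ne mvw]
  have le: "d l \<le> degree ?E l" if "l \<in> {1..n}" "l < j" for l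
  proof -
    have "d l \<le> degree E l" using inv that by (auto simp: cell_inv_def row_inv_def col_inv_def)
    then show ?thesis using mv(3)[of l] True that by (cases "l = i") auto
  qed
  have sums: "(\<Sum>l=1..k. degree ?E l) = (\<Sum>l=1..k. degree E l)" if "k \<in> {j..n}" for k
  proof -
    have "(\<Sum>l=1..k. degree ?E l + of_bool (l = i)) = (\<Sum>l=1..k. degree E l + of_bool (l = j))"
      by (simp add: mv(3))
    moreover have "(\<Sum>l=1..k. of_bool (l = i)) = (1::nat)" "(\<Sum>l=1..k. of_bool (l = j)) = (1::nat)"
      using that ij iw by (simp_all add: of_bool_def)
    ultimately show ?thesis by (simp only: sum.distrib)
  qed
  have col: "col_inv n m d j ?E"
    unfolding col_inv_def using mv(1,2) le sums inv
    by (auto simp: cell_inv_def row_inv_def col_inv_def)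
  have row: "degree ?E l \<le> d l \<or> d j \<le> degree ?E j" if "1 \<le> l" "l < i" "l < j" for l
  proof -
    have "degree E l \<le> d l" using inv True that by (force simp: cell_inv_def row_inv_def)
    then show ?thesis using mv(3)[of l] that by auto
  qed
  have rest: "\<not> movable i j v ?E" if "v < Suc w" for v
  proof (cases "v = w")
    case True
    then show ?thesis by (auto simp: movable_def move_edge_def doubleton_eq_iff)
  next
    case False
    then have "v < w" using that by simp
    then have "\<not> movable i j v E" using inv True by (auto simp: cell_inv_def)
    then show ?thesis using ne True by (auto simp: movable_def move_edge_def doubleton_eq_iff)
  qed
  show ?thesis unfolding E cell_inv_def row_inv_def using col row rest by auto
qed

text \<open>
  If \<open>i\<close> still has a surplus and \<open>j\<close> a deficit, then \<open>degree E j < d j \<le> d i < degree E i\<close>, so some edge at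
  \<open>i\<close> is movable; but all of them have been tried. This is where the order of \<open>d\<close> is used.
\<close>

lemma transfer_row_end:
  assumes d: "nonincreasing n d" and inv: "cell_inv n m d j i (Suc n) E" and j: "j \<le> n"
  shows "row_inv n m d j (Suc i) E"
proof -
  have row: "row_inv n m d j i E" and G: "simple_graph n E"
    using inv by (auto simp: cell_inv_def row_inv_def col_inv_def)
  have "degree E i \<le> d i \<or> d j \<le> degree E j" if i: "1 \<le> i" "i < j"
  proof (rule ccontr)
    assume contra: "\<not> ?thesis"
    have "d j \<le> d i" using d i j by (auto simp: nonincreasing_def)
    then have "degree E j < degree E i" using contra by simp
    then obtain w where "w \<le> n" "movable i j w E" by (rule movable_exists[OF G])
    then show False using inv contra i by (auto simp: cell_inv_def)
  qed
  then show ?thesis using row by (auto simp: row_inv_def less_Suc_eq)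
qed

text \<open>
  If \<open>j\<close> kept its deficit, no vertex in front of it would have a surplus, and the prefix sum up to \<open>j\<close> would
  be too small.
\<close>

lemma transfer_col_end:
  assumes inv: "row_inv n m d j (Suc n) E" and j: "j \<le> n"
  shows "col_inv n m d (Suc j) E"
proof -
  have col: "col_inv n m d j E" using inv by (simp add: row_inv_def)
  have "d j \<le> degree E j" if "1 \<le> j"
  proof (rule ccontr)
    assume contra: "\<not> ?thesis"
    then have "(\<Sum>l=1..j. degree E l) < (\<Sum>l=1..j. d l)"
    proof (intro sum_strict_mono_ex1 ballI)
      fix l assume l: "l \<in> {1..j}"
      show "degree E l \<le> d l"
        using inv l j contra by (cases "l = j") (auto simp: row_inv_def)
    qed (use that contra in \<open>auto intro!: bexI[of _ j]\<close>)
    then show False using col j by (auto simp: col_inv_def dest!: bspec[of _ _ j])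
  qed
  then show ?thesis using col by (auto simp: col_inv_def less_Suc_eq)
qed

text \<open>
  No vertex has a deficit, and both degree sequences have the sum \<open>2 * m\<close>.
\<close>

lemma transfer_end:
  assumes eg: "erdos_gallai n m d" and inv: "col_inv n m d (Suc n) E"
  shows "simple_graph n E" "card E = m" "\<And>i. i \<in> {1..n} \<Longrightarrow> degree E i = d i"
proof -
  show G: "simple_graph n E" "card E = m" using inv by (auto simp: col_inv_def)
  have sum: "(\<Sum>i=1..n. d i) = (\<Sum>i=1..n. degree E i)"
    using handshake[OF G(1)] G(2) eg by (simp add: erdos_gallai_def)
  fix i assume i: "i \<in> {1..n}"
  have le: "\<And>l. l \<in> {1..n} \<Longrightarrow> d l \<le> degree E l" using inv by (auto simp: col_inv_def)
  show "degree E i = d i"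
    using sum_mono_inv[OF sum le i] by simp
qed

lemma transfer_start:
  assumes eg: "erdos_gallai n m d" and card: "card (staircase n d i0 j0) = m"
  shows "col_inv n m d 0 (staircase n d i0 j0)"
  unfolding col_inv_def using staircase_simple card staircase_dominates[OF eg card] by auto

section \<open>Reading a sequence from both ends\<close>

text \<open>
  A nonincreasing sequence is read from both ends. In the state \<open>(k, a, b, p, q)\<close> the entries \<open>1, \<dots>, k\<close> and
  those behind \<open>b\<close> are known, and all entries between have values from \<open>k\<close> to \<open>a\<close>. Entries equal to
  \<open>k\<close> are read at the right end; when none is left, the entry \<open>k + 1\<close> is read at the left end. At
  that moment \<open>b\<close> is the number of entries greater than \<open>k\<close>, which is the term \<open>k + 1\<close> of the conjugate. Hence
  \<open>p\<close> and \<open>q\<close>, the sums of the first \<open>k\<close> terms of the sequence and of its conjugate, are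
  updated by \<open>a\<close> and \<open>b\<close>, and the Erdos-Gallai inequality becomes a condition on the state. At the end
  \<open>k = b\<close> is the side of the Durfee square, which both sums count, so that the sum of the sequence is
  \<open>p + q - k * k\<close>.
\<close>

inductive completion :: "nat \<Rightarrow> nat \<Rightarrow> nat \<Rightarrow> nat \<Rightarrow> nat \<Rightarrow> nat \<Rightarrow> (nat \<Rightarrow> nat) \<Rightarrow> bool" for m where
  stop: "p + q = k * k + 2 * m \<Longrightarrow> completion m k a k p q d"
| lower: "k < a \<Longrightarrow> completion m k (a - 1) b p q d \<Longrightarrow> completion m k a b p q d"
| right: "k < b \<Longrightarrow> d b = k \<Longrightarrow> completion m k a (b - 1) p q d \<Longrightarrow> completion m k a b p q d"
| left: "k < b \<Longrightarrow> k < a \<Longrightarrow> p + a \<le> 2 * m \<Longrightarrow> q + b \<le> 2 * m \<Longrightarrow> p + a + Suc k \<le> q + b \<Longrightarrow>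
    d (Suc k) = a \<Longrightarrow> completion m (Suc k) a b (p + a) (q + b) d \<Longrightarrow> completion m k a b p q d"

lemma completion_range:
  assumes "completion m k a b p q d" "k \<le> a" "k < i" "i \<le> b"
  shows "k \<le> d i \<and> d i \<le> a"
  using assms
proof (induction arbitrary: i rule: completion.induct)
  case (lower k a b p q d)
  then show ?case by fastforce
next
  case (right k b d a p q)
  then show ?case by (cases "i = b") auto
next
  case (left k b a p q d)
  show ?case using left.IH[of i] left.hyps left.prems by (cases "i = Suc k") auto
qed auto

lemma completion_nonincreasing:
  assumes "completion m k a b p q d" "k \<le> a" "k < i" "i \<le> j" "j \<le> b"
  shows "d j \<le> d i"
  using assms
proof (induction arbitrary: i j rule: completion.induct)
  case (right k b d a p q)
  show ?case
  proof (cases "j = b")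
    case True
    then show ?thesis
      using right completion_range[OF right.hyps(3), of i] by (cases "i = b") auto
  qed (use right in auto)
next
  case (left k b a p q d)
  show ?case
  proof (cases "i = Suc k")
    case True
    then show ?thesis
      using left.hyps left.prems(3,4) completion_range[OF left.hyps(7), of j] by (cases "j = i") simp_all
  next
    case False
    then have "Suc k < i" using left.prems by simp
    then show ?thesis using left.IH[of i j] left.prems left.hyps by simp
  qed
qed auto

text \<open>
  The minimum is \<open>k\<close> on the first \<open>k\<close> entries and is the entry itself on the others.
\<close>

lemma sum_min_const:
  fixes d :: "nat \<Rightarrow> nat"
  assumes "k \<le> n" "\<And>i. 1 \<le> i \<Longrightarrow> i \<le> k \<Longrightarrow> k \<le> d i" "\<And>i. k < i \<Longrightarrow> i \<le> n \<Longrightarrow> d i \<le> k"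
  shows "(\<Sum>i=1..k. d i) + (\<Sum>j=1..n. min (d j) k) = k * k + (\<Sum>i=1..n. d i)"
proof -
  have "(\<Sum>j=1..k. min (d j) k) = (\<Sum>j=1..k. k)" using assms(2) by (intro sum.cong) (auto intro: min.absorb2)
  moreover have "(\<Sum>j=Suc k..n. min (d j) k) = (\<Sum>j=Suc k..n. d j)" using assms by (intro sum.cong) auto
  ultimately show ?thesis
    using sum_split_at[OF assms(1), of d] sum_split_at[OF assms(1), of "\<lambda>j. min (d j) k"] by simp
qed

text \<open>
  Exactly the first \<open>b\<close> entries reach the column \<open>k + 1\<close> of the diagram.
\<close>

lemma sum_min_Suc:
  fixes d :: "nat \<Rightarrow> nat"
  assumes "b \<le> n" "\<And>i. 1 \<le> i \<Longrightarrow> i \<le> b \<Longrightarrow> k < d i" "\<And>i. b < i \<Longrightarrow> i \<le> n \<Longrightarrow> d i \<le> k"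
  shows "(\<Sum>j=1..n. min (d j) (Suc k)) = (\<Sum>j=1..n. min (d j) k) + b"
proof -
  have "(\<Sum>j=1..b. min (d j) (Suc k)) = (\<Sum>j=1..b. min (d j) k + 1)"
    using assms by (intro sum.cong refl) fastforce
  moreover have "(\<Sum>j=1..b. min (d j) k + 1) = (\<Sum>j=1..b. min (d j) k) + b"
    by (simp only: sum.distrib) simp
  moreover have "(\<Sum>j=Suc b..n. min (d j) (Suc k)) = (\<Sum>j=Suc b..n. min (d j) k)"
  proof (intro sum.cong refl)
    fix j assume "j \<in> {Suc b..n}"
    then have "d j \<le> k" using assms(3)[of j] by simp
    then show "min (d j) (Suc k) = min (d j) k" by simp
  qed
  ultimately show ?thesis
    using sum_split_at[OF assms(1), of "\<lambda>j. min (d j) k"]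
      sum_split_at[OF assms(1), of "\<lambda>j. min (d j) (Suc k)"] by simp
qed

text \<open>
  Along the walk \<open>p\<close> and \<open>q\<close> are the announced sums. Each step at the left end therefore checks
  the inequality for the index \<open>k + 1\<close>. An index behind the last state lies outside the Durfee square.
\<close>

lemma completion_sums:
  assumes "completion m k a b p q d" "k \<le> a" "b \<le> n"
    and "\<And>i. 1 \<le> i \<Longrightarrow> i \<le> k \<Longrightarrow> a \<le> d i" "\<And>i. b < i \<Longrightarrow> i \<le> n \<Longrightarrow> d i \<le> k"
    and "p = (\<Sum>i=1..k. d i)" "q = (\<Sum>j=1..n. min (d j) k)"
  shows "(\<Sum>i=1..n. d i) = 2 * m \<and>
    (\<forall>l. k < l \<and> l \<le> n \<and> l \<le> d l \<longrightarrow> (\<Sum>i=1..l. d i) + l \<le> (\<Sum>j=1..n. min (d j) l))"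
  using assms
proof (induction rule: completion.induct)
  case (stop p q k a d)
  have "p + q = k * k + (\<Sum>i=1..n. d i)"
    unfolding stop.prems(5,6)
  proof (rule sum_min_const)
    show "\<And>i. 1 \<le> i \<Longrightarrow> i \<le> k \<Longrightarrow> k \<le> d i" using stop.prems(1,3) by (meson le_trans)
  qed (use stop in auto)
  then show ?case using stop by fastforce
next
  case (lower k a b p q d)
  then show ?case by (intro lower.IH) fastforce+
next
  case (right k b d a p q)
  show ?case
  proof (rule right.IH)
    fix i assume "b - 1 < i" "i \<le> n"
    then show "d i \<le> k" using right.prems(4)[of i] right.hyps(2) by (cases "i = b") auto
  qed (use right in auto)
next
  case (left k b a p q d)
  have big: "k < d i" if i: "1 \<le> i" "i \<le> b" for i
  proof -
    consider "i \<le> k" | "i = Suc k" | "Suc k < i" by linarith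
    then show ?thesis
    proof cases
      case 1 then show ?thesis using left.prems(3)[of i] left.hyps(2) i by simp
    next
      case 2 then show ?thesis using left.hyps by simp
    next
      case 3 then show ?thesis using completion_range[OF left.hyps(7), of i] left.hyps(2) i by simp
    qed
  qed
  have p: "p + a = (\<Sum>i=1..Suc k. d i)" using left by simp
  have q: "q + b = (\<Sum>j=1..n. min (d j) (Suc k))"
    using sum_min_Suc[of b n k d] big left.prems by simp
  have IH: "(\<Sum>i=1..n. d i) = 2 * m \<and>
    (\<forall>l. Suc k < l \<and> l \<le> n \<and> l \<le> d l \<longrightarrow> (\<Sum>i=1..l. d i) + l \<le> (\<Sum>j=1..n. min (d j) l))"
  proof (rule left.IH)
    show "\<And>i. 1 \<le> i \<Longrightarrow> i \<le> Suc k \<Longrightarrow> a \<le> d i" using left.prems(3) left.hyps(6) by (metis le_Suc_eq order_refl)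
    show "\<And>i. b < i \<Longrightarrow> i \<le> n \<Longrightarrow> d i \<le> Suc k" using left.prems(4) le_SucI by blast
  qed (use left p q in auto)
  have "(\<Sum>i=1..Suc k. d i) + Suc k \<le> (\<Sum>j=1..n. min (d j) (Suc k))"
    using left.hyps(5) by (simp only: p[symmetric] q[symmetric])
  then show ?case using IH by (metis Suc_lessI)
qed

lemma completion_erdos_gallai:
  assumes "completion m 0 n n 0 0 d"
  shows "erdos_gallai n m d"
proof -
  have "(\<Sum>i=1..n. d i) = 2 * m \<and>
    (\<forall>l. 0 < l \<and> l \<le> n \<and> l \<le> d l \<longrightarrow> (\<Sum>i=1..l. d i) + l \<le> (\<Sum>j=1..n. min (d j) l))"
    by (rule completion_sums[OF assms]) auto
  moreover have "nonincreasing n d"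
    using completion_nonincreasing[OF assms] by (auto simp: nonincreasing_def)
  ultimately show ?thesis by (auto simp: erdos_gallai_def)
qed

text \<open>
  The walk is forced: read the right end as long as its entry is \<open>k\<close>. Otherwise every entry up to \<open>b\<close> exceeds
  \<open>k\<close>; lower \<open>a\<close> to the entry \<open>k + 1\<close> and read that one. The bound \<open>2 * m\<close> on both sums holds because
  each is a part of the whole diagram.
\<close>

lemma erdos_gallai_completion_from:
  assumes eg: "erdos_gallai n m d"
    and "k \<le> b" "b \<le> n" "k \<le> a"
    and "\<And>i. 1 \<le> i \<Longrightarrow> i \<le> b \<Longrightarrow> k \<le> d i" "\<And>i. b < i \<Longrightarrow> i \<le> n \<Longrightarrow> d i \<le> k"
    and "\<And>i. k < i \<Longrightarrow> i \<le> b \<Longrightarrow> d i \<le> a"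
    and "p = (\<Sum>i=1..k. d i)" "q = (\<Sum>j=1..n. min (d j) k)"
  shows "completion m k a b p q d"
  using assms(2-)
proof (induction "(b - k) + a + b" arbitrary: k a b p q rule: less_induct)
  case less
  have mono: "d j \<le> d i" if "1 \<le> i" "i \<le> j" "j \<le> n" for i j
    using eg that by (auto simp: erdos_gallai_def nonincreasing_def)
  have tot: "(\<Sum>i=1..n. d i) = 2 * m" using eg by (simp add: erdos_gallai_def)
  show ?case
  proof (cases "k = b")
    case True
    have "p + q = k * k + 2 * m"
      unfolding less.prems(7,8) tot[symmetric]
      using less.prems True by (intro sum_min_const) auto
    then show ?thesis using True by (auto intro: completion.stop)
  next
    case False
    then have kb: "k < b" using less.prems by simp
    show ?thesis
    proof (cases "d b = k")
      case True
      have "d i \<le> k" if "b - 1 < i" "i \<le> n" for i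
        using less.prems(5)[of i] True that by (cases "i = b") auto
      then have "completion m k a (b - 1) p q d"
        using less.prems kb by (intro less.hyps) auto
      then show ?thesis using kb True by (auto intro: completion.right)
    next
      case False
      then have dbk: "k < d b" using less.prems(4)[of b] kb by simp
      have big: "k < d i" if "1 \<le> i" "i \<le> b" for i
        using mono[of i b] that dbk less.prems by simp
      have small: "d i \<le> d (Suc k)" if "k < i" "i \<le> b" for i
        using mono[of "Suc k" i] that less.prems by simp
      have dk: "k < d (Suc k)" "d (Suc k) \<le> a" using big[of "Suc k"] kb less.prems(6)[of "Suc k"] by auto
      show ?thesis
      proof (cases "d (Suc k) = a")
        case True
        have p: "p + a = (\<Sum>i=1..Suc k. d i)" using less.prems True by simp
        have q: "q + b = (\<Sum>j=1..n. min (d j) (Suc k))"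
          using sum_min_Suc[of b n k d] big less.prems by simp
        have "Suc k \<in> {1..n}" "Suc k \<le> d (Suc k)" using dk kb less.prems(2) by auto
        then have "p + a + Suc k \<le> q + b" using eg unfolding p q erdos_gallai_def by blast
        moreover have "p + a \<le> 2 * m"
          unfolding p tot[symmetric] using kb less.prems(2) by (intro sum_mono2) auto
        moreover have "q + b \<le> 2 * m"
          unfolding q tot[symmetric] by (intro sum_mono) auto
        moreover have "completion m (Suc k) a b (p + a) (q + b) d"
        proof (rule less.hyps)
          show "\<And>i. 1 \<le> i \<Longrightarrow> i \<le> b \<Longrightarrow> Suc k \<le> d i" using big by (simp add: Suc_leI)
          show "\<And>i. b < i \<Longrightarrow> i \<le> n \<Longrightarrow> d i \<le> Suc k" using less.prems(5) le_SucI by blast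
          show "\<And>i. Suc k < i \<Longrightarrow> i \<le> b \<Longrightarrow> d i \<le> a" using small True by simp
        qed (use kb dk True less.prems p q in auto)
        ultimately show ?thesis using kb dk True by (auto intro: completion.left)
      next
        case False
        then have da: "d (Suc k) < a" using dk by simp
        have "d i \<le> a - 1" if "k < i" "i \<le> b" for i using small[OF that] da by simp
        then have "completion m k (a - 1) b p q d"
          using less.prems da dk by (intro less.hyps) auto
        then show ?thesis using da dk by (auto intro: completion.lower)
      qed
    qed
  qed
qed

lemma erdos_gallai_completion:
  assumes eg: "erdos_gallai n m d" shows "completion m 0 n n 0 0 d"
proof (rule erdos_gallai_completion_from[OF eg])
  fix i assume i: "0 < i" "i \<le> n"
  have "d i \<le> d 1" using eg i by (auto simp: erdos_gallai_def nonincreasing_def)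
  moreover have "d 1 \<le> n"
  proof (cases "1 \<le> d 1")
    case True
    then have "(\<Sum>i=1..1. d i) + 1 \<le> (\<Sum>j=1..n. min (d j) 1)" using eg i by (simp only: erdos_gallai_def) auto
    also have "\<dots> \<le> (\<Sum>j=1..n. 1)" by (intro sum_mono) auto
    finally show ?thesis by simp
  qed simp
  ultimately show "d i \<le> n" by simp
qed auto

section \<open>The dynamic program\<close>

text \<open>
  A pair consists of the code of a move, with \<open>0\<close> for an infeasible state, and of a value that is meaningful
  only if the code is not \<open>0\<close>.
\<close>

definition relax :: "nat \<Rightarrow> real \<Rightarrow> nat \<times> real \<Rightarrow> nat \<times> real \<Rightarrow> nat \<times> real" where
  "relax code w cand best =
     (if 0 < fst cand \<and> (fst best = 0 \<or> snd best < snd cand + w) then (code, snd cand + w) else best)"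

text \<open>
  The largest value that the unread entries can contribute, together with the move that attains it: \<open>1\<close> for
  \<open>stop\<close>, \<open>2\<close> for \<open>lower\<close>, \<open>3\<close> for \<open>right\<close> and \<open>4\<close> for \<open>left\<close>. A move whose precondition fails is
  represented by the infeasible pair.
\<close>

function best :: "nat \<Rightarrow> (nat \<Rightarrow> real) \<Rightarrow> nat \<Rightarrow> nat \<Rightarrow> nat \<Rightarrow> nat \<Rightarrow> nat \<Rightarrow> nat \<times> real" where
  "best m f k a b p q =
     relax 4 (f a)
       (if k < b \<and> k < a \<and> p + a \<le> 2 * m \<and> q + b \<le> 2 * m \<and> p + a + Suc k \<le> q + b
        then best m f (Suc k) a b (p + a) (q + b) else (0, 0))
     (relax 3 (f k) (if k < b then best m f k a (b - 1) p q else (0, 0))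
     (relax 2 0 (if k < a then best m f k (a - 1) b p q else (0, 0))
     (if k = b \<and> p + q = k * k + 2 * m then (1, 0) else (0, 0))))"
  by pat_completeness auto
termination by (relation "measure (\<lambda>(m, f, k, a, b, p, q). (b - k) + a + b)") auto

declare best.simps [simp del]

definition attains :: "real \<Rightarrow> nat \<times> real \<Rightarrow> bool" where
  "attains v x \<longleftrightarrow> 0 < fst x \<and> v \<le> snd x"

lemma attains_relax_keep: "attains v x \<Longrightarrow> 0 < code \<Longrightarrow> attains v (relax code w cand x)"
  by (auto simp: attains_def relax_def)

lemma attains_relax_cand: "attains v cand \<Longrightarrow> 0 < code \<Longrightarrow> attains (v + w) (relax code w cand x)"
  by (auto simp: attains_def relax_def)

lemma best_upper:
  assumes "completion m k a b p q d"
  shows "attains (\<Sum>i\<in>{k<..b}. f (d i)) (best m f k a b p q)"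
  using assms
proof (induction rule: completion.induct)
  case (stop p q k a d)
  show ?case
    by (subst best.simps) (intro attains_relax_keep, use stop in \<open>auto simp: attains_def\<close>)
next
  case (lower k a b p q d)
  then have "attains ((\<Sum>i\<in>{k<..b}. f (d i)) + 0) (best m f k a b p q)"
    by (subst best.simps) (intro attains_relax_keep attains_relax_cand, auto)
  then show ?case by simp
next
  case (right k b d a p q)
  then have "attains ((\<Sum>i\<in>{k<..b - 1}. f (d i)) + f k) (best m f k a b p q)"
    by (subst best.simps) (rule attains_relax_keep, intro attains_relax_cand, auto)
  moreover have "{k<..b} = insert b {k<..b - 1}" using right.hyps by auto
  ultimately show ?case using right.hyps by (simp add: add.commute)
next
  case (left k b a p q d)
  then have "attains ((\<Sum>i\<in>{Suc k<..b}. f (d i)) + f a) (best m f k a b p q)"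
    by (subst best.simps) (intro attains_relax_cand, auto)
  moreover have "{k<..b} = insert (Suc k) {Suc k<..b}" using left.hyps by auto
  ultimately show ?case using left.hyps by (simp add: add.commute)
qed

lemma relax_chain:
  fixes c4 w4 k4 c3 w3 k3 c2 w2 k2 x
  defines "y \<equiv> relax c4 w4 k4 (relax c3 w3 k3 (relax c2 w2 k2 x))"
  shows "fst k4 \<noteq> 0 \<and> y = (c4, snd k4 + w4) \<or> fst k3 \<noteq> 0 \<and> y = (c3, snd k3 + w3) \<or>
    fst k2 \<noteq> 0 \<and> y = (c2, snd k2 + w2) \<or> y = x"
  unfolding y_def relax_def by (simp split: if_split)

text \<open>
  The stored move leads to a feasible state whose value differs by the entry that the move reads. This is
  what allows an optimal sequence to be read off the table.
\<close>

lemma best_step: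
  assumes "fst (best m f k a b p q) \<noteq> 0"
  shows "fst (best m f k a b p q) = 1 \<and> snd (best m f k a b p q) = 0 \<and> k = b \<and> p + q = k * k + 2 * m \<or>
    fst (best m f k a b p q) = 2 \<and> k < a \<and> fst (best m f k (a - 1) b p q) \<noteq> 0 \<and>
      snd (best m f k a b p q) = snd (best m f k (a - 1) b p q) \<or>
    fst (best m f k a b p q) = 3 \<and> k < b \<and> fst (best m f k a (b - 1) p q) \<noteq> 0 \<and>
      snd (best m f k a b p q) = snd (best m f k a (b - 1) p q) + f k \<or>
    fst (best m f k a b p q) = 4 \<and> k < b \<and> k < a \<and> p + a \<le> 2 * m \<and> q + b \<le> 2 * m \<and>
      p + a + Suc k \<le> q + b \<and> fst (best m f (Suc k) a b (p + a) (q + b)) \<noteq> 0 \<and>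
      snd (best m f k a b p q) = snd (best m f (Suc k) a b (p + a) (q + b)) + f a"
proof -
  let ?c1 = "if k = b \<and> p + q = k * k + 2 * m then (1, 0) else (0, 0 :: real)"
  let ?k2 = "if k < a then best m f k (a - 1) b p q else (0, 0)"
  let ?k3 = "if k < b then best m f k a (b - 1) p q else (0, 0)"
  let ?k4 = "if k < b \<and> k < a \<and> p + a \<le> 2 * m \<and> q + b \<le> 2 * m \<and> p + a + Suc k \<le> q + b
        then best m f (Suc k) a b (p + a) (q + b) else (0, 0)"
  let ?c2 = "relax 2 0 ?k2 ?c1"
  let ?c3 = "relax 3 (f k) ?k3 ?c2"
  let ?c4 = "relax 4 (f a) ?k4 ?c3"
  have B: "best m f k a b p q = ?c4" by (rule best.simps)
  consider "fst ?k4 \<noteq> 0 \<and> ?c4 = (4, snd ?k4 + f a)" | "fst ?k3 \<noteq> 0 \<and> ?c4 = (3, snd ?k3 + f k)"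
    | "fst ?k2 \<noteq> 0 \<and> ?c4 = (2, snd ?k2 + 0)" | "?c4 = ?c1"
    using relax_chain[where ?c4.0 = 4 and ?w4.0 = "f a" and ?k4.0 = ?k4 and ?c3.0 = 3 and ?w3.0 = "f k" and ?k3.0 = ?k3
        and ?c2.0 = 2 and ?w2.0 = 0 and ?k2.0 = ?k2 and x = ?c1] by fast
  then show ?thesis
  proof cases
    case 1 then show ?thesis unfolding B by (auto split: if_splits)
  next
    case 2 then show ?thesis unfolding B by (auto split: if_splits)
  next
    case 3 then show ?thesis unfolding B by (auto split: if_splits)
  next
    case 4 then show ?thesis using assms unfolding B by (auto split: if_splits)
  qed
qed

section \<open>Reasoning about timed programs\<close>

text \<open>
  Total correctness with a time bound: \<open>c\<close> started in \<open>s\<close> halts within \<open>T\<close> units in a state that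
  satisfies \<open>Q\<close>. Sequences of commands are treated by nesting, as in \<open>runs_Seq\<close>.
\<close>

definition runs :: "com \<Rightarrow> state \<Rightarrow> nat \<Rightarrow> (state \<Rightarrow> bool) \<Rightarrow> bool" where
  "runs c s T Q \<longleftrightarrow> (\<exists>t s'. exec c s t s' \<and> t \<le> T \<and> Q s')"

lemma runs_weaken:
  assumes "runs c s T Q" "T \<le> T'" "\<And>s'. Q s' \<Longrightarrow> Q' s'"
  shows "runs c s T' Q'"
  using assms unfolding runs_def by (meson le_trans)

lemma runs_Seq:
  assumes "runs c1 s T1 (\<lambda>s'. runs c2 s' T2 Q)" "T1 + T2 \<le> T"
  shows "runs (Seq c1 c2) s T Q"
  using assms unfolding runs_def by (meson add_mono exec.Seq le_trans)

primrec loopfree :: "com \<Rightarrow> bool" where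
  "loopfree Skip \<longleftrightarrow> True"
| "loopfree (NAssign x a) \<longleftrightarrow> True"
| "loopfree (NStore x i a) \<longleftrightarrow> True"
| "loopfree (RAssign x a) \<longleftrightarrow> True"
| "loopfree (RStore x i a) \<longleftrightarrow> True"
| "loopfree (Seq c1 c2) \<longleftrightarrow> loopfree c1 \<and> loopfree c2"
| "loopfree (If b c1 c2) \<longleftrightarrow> loopfree c1 \<and> loopfree c2"
| "loopfree (While b c) \<longleftrightarrow> False"

text \<open>
  The final state of a loop-free command. The clauses for loops here and in \<open>max_time\<close> are default values.
\<close>

primrec effect :: "com \<Rightarrow> state \<Rightarrow> state" where
  "effect Skip s = s"
| "effect (NAssign x a) s = s\<lparr>nvar := (nvar s)(x := nval a s)\<rparr>"
| "effect (NStore x i a) s = s\<lparr>narr := (narr s)(x := (narr s x)(nval i s := nval a s))\<rparr>"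
| "effect (RAssign x a) s = s\<lparr>rvar := (rvar s)(x := rval a s)\<rparr>"
| "effect (RStore x i a) s = s\<lparr>rarr := (rarr s)(x := (rarr s x)(nval i s := rval a s))\<rparr>"
| "effect (Seq c1 c2) s = effect c2 (effect c1 s)"
| "effect (If b c1 c2) s = (if bval b s then effect c1 s else effect c2 s)"
| "effect (While b c) s = s"

text \<open>
  For a conditional, the times of both branches are added, which bounds either of them.
\<close>

primrec max_time :: "com \<Rightarrow> nat" where
  "max_time Skip = 1"
| "max_time (NAssign x a) = 1 + ncost a"
| "max_time (NStore x i a) = 1 + ncost i + ncost a"
| "max_time (RAssign x a) = 1 + rcost a"
| "max_time (RStore x i a) = 1 + ncost i + rcost a"
| "max_time (Seq c1 c2) = max_time c1 + max_time c2"
| "max_time (If b c1 c2) = 1 + bcost b + (max_time c1 + max_time c2)"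
| "max_time (While b c) = 0"

lemma runs_loopfree:
  assumes "loopfree c" "max_time c \<le> T" "Q (effect c s)"
  shows "runs c s T Q"
proof -
  have "\<exists>t. exec c s t (effect c s) \<and> t \<le> max_time c" using assms(1)
  proof (induction c arbitrary: s)
    case (Seq c1 c2)
    then show ?case by (fastforce intro: exec.Seq add_mono)
  next
    case (If b c1 c2)
    show ?case
    proof (cases "bval b s")
      case True
      obtain t where "exec c1 s t (effect c1 s)" "t \<le> max_time c1" using If by auto
      then show ?thesis using True by (fastforce intro: exec.IfTrue)
    next
      case False
      obtain t where "exec c2 s t (effect c2 s)" "t \<le> max_time c2" using If by auto
      then show ?thesis using False by (fastforce intro: exec.IfFalse)
    qed
  qed (auto intro: exec.intros simp del: fun_upd_apply)
  then show ?thesis using assms(2,3) unfolding runs_def by (meson le_trans)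
qed

text \<open>
  The variables and arrays that a command may change according to its text. Everything else is preserved,
  so that loop invariants need to mention only what the loop changes.
\<close>

primrec nmods :: "com \<Rightarrow> vname set" where
  "nmods Skip = {}"
| "nmods (NAssign x a) = {x}"
| "nmods (NStore x i a) = {}"
| "nmods (RAssign x a) = {}"
| "nmods (RStore x i a) = {}"
| "nmods (Seq c1 c2) = nmods c1 \<union> nmods c2"
| "nmods (If b c1 c2) = nmods c1 \<union> nmods c2"
| "nmods (While b c) = nmods c"

primrec amods :: "com \<Rightarrow> vname set" where
  "amods Skip = {}"
| "amods (NAssign x a) = {}"
| "amods (NStore x i a) = {x}"
| "amods (RAssign x a) = {}"
| "amods (RStore x i a) = {}"
| "amods (Seq c1 c2) = amods c1 \<union> amods c2"
| "amods (If b c1 c2) = amods c1 \<union> amods c2"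
| "amods (While b c) = amods c"

primrec rmods :: "com \<Rightarrow> vname set" where
  "rmods Skip = {}"
| "rmods (NAssign x a) = {}"
| "rmods (NStore x i a) = {}"
| "rmods (RAssign x a) = {}"
| "rmods (RStore x i a) = {x}"
| "rmods (Seq c1 c2) = rmods c1 \<union> rmods c2"
| "rmods (If b c1 c2) = rmods c1 \<union> rmods c2"
| "rmods (While b c) = rmods c"

definition frame :: "com \<Rightarrow> state \<Rightarrow> state \<Rightarrow> bool" where
  "frame c s s' \<longleftrightarrow> (\<forall>x. x \<notin> nmods c \<longrightarrow> nvar s' x = nvar s x) \<and>
     (\<forall>x. x \<notin> amods c \<longrightarrow> narr s' x = narr s x) \<and>
     (\<forall>x. x \<notin> rmods c \<longrightarrow> rarr s' x = rarr s x)"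

lemma exec_frame: "exec c s t s' \<Longrightarrow> frame c s s'"
  by (induction rule: exec.induct) (auto simp: frame_def)

lemma runs_frame:
  assumes "runs c s T Q" shows "runs c s T (\<lambda>s'. Q s' \<and> frame c s s')"
  using assms exec_frame unfolding runs_def by blast

definition For :: "vname \<Rightarrow> nexp \<Rightarrow> com \<Rightarrow> com" where
  "For x e c = Seq (NAssign x (NConst 0))
     (While (NLess (NVar x) e) (Seq c (NAssign x (NAdd (NVar x) (NConst 1)))))"

lemma For_mods [simp]:
  "nmods (For x e c) = insert x (nmods c)" "amods (For x e c) = amods c" "rmods (For x e c) = rmods c"
  by (auto simp: For_def)

lemma runs_WhileFalse:
  assumes "\<not> bval b s" "Q s" "1 + bcost b \<le> T"
  shows "runs (While b c) s T Q"
  using assms unfolding runs_def by (meson exec.WhileFalse)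

lemma runs_WhileTrue:
  assumes "bval b s" "runs c s T1 (\<lambda>s'. runs (While b c) s' T2 Q)" "1 + bcost b + T1 + T2 \<le> T"
  shows "runs (While b c) s T Q"
proof -
  obtain t1 s1 t2 s2 where "exec c s t1 s1" "t1 \<le> T1" "exec (While b c) s1 t2 s2" "t2 \<le> T2" "Q s2"
    using assms(2) unfolding runs_def by blast
  moreover from this have "exec (While b c) s (1 + bcost b + t1 + t2) s2"
    using assms(1) by (blast intro: exec.WhileTrue)
  moreover have "1 + bcost b + t1 + t2 \<le> T" using assms(3) calculation(2,4) by linarith
  ultimately show ?thesis unfolding runs_def by blast
qed

text \<open>
  An invariant that speaks of the counter is stated for the state in which the counter has
  already been set. The frame relates the current state to the initial one, which is how a proof about the body
  knows the values of untouched variables. One round takes at most \<open>T + ncost e + 7\<close> units; the round counted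
  in addition by \<open>H + 1\<close> pays for the last test and for the initial assignment.
\<close>

lemma runs_For:
  assumes start: "I 0 (s0\<lparr>nvar := (nvar s0)(x := 0)\<rparr>)"
    and step: "\<And>k s. k < H \<Longrightarrow> I k s \<Longrightarrow> nvar s x = k \<Longrightarrow> frame (For x e c) s0 s \<Longrightarrow>
      runs c s T (\<lambda>s'. I (Suc k) (s'\<lparr>nvar := (nvar s')(x := Suc k)\<rparr>))"
    and x: "x \<notin> nmods c"
    and hi: "\<And>s. frame (For x e c) s0 s \<Longrightarrow> nval e s = H"
    and fin: "\<And>s. I H s \<Longrightarrow> frame (For x e c) s0 s \<Longrightarrow> Q s"
    and T': "(H + 1) * (T + ncost e + 9) \<le> T'"
  shows "runs (For x e c) s0 T' Q"
proof -
  let ?b = "NLess (NVar x) e" and ?c = "Seq c (NAssign x (NAdd (NVar x) (NConst 1)))"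
  let ?U = "T + ncost e + 9"
  \<comment> \<open>The subtracted \<open>2\<close> is the cost of setting the counter to \<open>0\<close>.\<close>
  have loop: "runs (While ?b ?c) s ((r + 1) * ?U - 2) Q"
    if "k + r = H" "I k s" "nvar s x = k" "frame (For x e c) s0 s" for k r s
    using that
  proof (induction r arbitrary: k s)
    case 0
    then show ?case using hi fin by (intro runs_WhileFalse) auto
  next
    case (Suc r)
    have k: "k < H" using Suc.prems by simp
    show ?case
    proof (rule runs_WhileTrue)
      show "bval ?b s" using Suc.prems hi k by simp
      show "runs ?c s (T + 4) (\<lambda>s'. runs (While ?b ?c) s' ((r + 1) * ?U - 2) Q)"
      proof (rule runs_Seq)
        show "runs c s T (\<lambda>s'. runs (NAssign x (NAdd (NVar x) (NConst 1))) s' 4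
            (\<lambda>s'. runs (While ?b ?c) s' ((r + 1) * ?U - 2) Q))"
        proof (rule runs_weaken[OF runs_frame[OF step[OF k Suc.prems(2-4)]] order_refl])
          fix s' assume s': "I (Suc k) (s'\<lparr>nvar := (nvar s')(x := Suc k)\<rparr>) \<and> frame c s s'"
          then have xk: "nvar s' x = k" using x Suc.prems by (auto simp: frame_def)
          let ?s = "s'\<lparr>nvar := (nvar s')(x := Suc k)\<rparr>"
          have fr: "frame (For x e c) s0 ?s" using s' Suc.prems(4) by (auto simp: frame_def)
          have "runs (While ?b ?c) ?s ((r + 1) * ?U - 2) Q"
            using Suc.prems(1) s' fr by (intro Suc.IH[of "Suc k"]) auto
          then show "runs (NAssign x (NAdd (NVar x) (NConst 1))) s' 4
              (\<lambda>s'. runs (While ?b ?c) s' ((r + 1) * ?U - 2) Q)"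
            using xk by - (rule runs_loopfree, auto)
        qed
      qed simp
    qed (simp add: algebra_simps)
  qed
  show ?thesis
    unfolding For_def
  proof (rule runs_Seq)
    let ?s = "s0\<lparr>nvar := (nvar s0)(x := 0)\<rparr>"
    have "frame (For x e c) s0 ?s" by (auto simp: frame_def)
    then have "runs (While ?b ?c) ?s ((H + 1) * ?U - 2) Q"
      using start by (intro loop[of 0]) auto
    then show "runs (NAssign x (NConst 0)) s0 2 (\<lambda>s'. runs (While ?b ?c) s' ((H + 1) * ?U - 2) Q)"
      by - (rule runs_loopfree, auto)
    show "2 + ((H + 1) * ?U - 2) \<le> T'" using T' by (simp add: algebra_simps)
  qed
qed

lemma effect_frame: "loopfree c \<Longrightarrow> frame c s (effect c s)"
  by (induction c arbitrary: s) (fastforce simp: frame_def)+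

section \<open>Filling the table\<close>

text \<open>
  The table is stored in linear arrays with mixed-radix indices. The leading digit is \<open>h = n - k\<close>
  instead of \<open>k\<close>, so that all successors of a state in a walk have smaller indices and one loop in
  the order of the indices can fill the table.
\<close>

definition cell_index :: "nat \<Rightarrow> nat \<Rightarrow> nat \<Rightarrow> nat \<Rightarrow> nat \<Rightarrow> nat \<Rightarrow> nat \<Rightarrow> nat" where
  "cell_index N M h a b p q = (((h * N + a) * N + b) * M + p) * M + q"

lemma pair_less:
  fixes x :: nat assumes "x < x'" "y < N" shows "x * N + y < x' * N + y'"
proof -
  have "x * N + y < Suc x * N" using assms by simp
  also have "\<dots> \<le> x' * N" using assms by (intro mult_le_mono1) simp
  finally show ?thesis by simp
qed

lemma pair_eq:
  fixes x :: nat assumes "y < N" "y' < N" shows "x * N + y = x' * N + y' \<longleftrightarrow> x = x' \<and> y = y'"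
  using pair_less[of x x' y N y'] pair_less[of x' x y' N y] assms by (metis nat_neq_iff add_left_cancel)

lemma cell_index_eq:
  assumes "a < N" "a' < N" "b < N" "b' < N" "p < M" "p' < M" "q < M" "q' < M"
  shows "cell_index N M h a b p q = cell_index N M h' a' b' p' q' \<longleftrightarrow>
    h = h' \<and> a = a' \<and> b = b' \<and> p = p' \<and> q = q'"
  using assms by (auto simp: cell_index_def pair_eq)

lemma cell_index_less:
  assumes "a < N" "b < N" "p < M" "q < M"
  shows "h < h' \<Longrightarrow> cell_index N M h a b p q < cell_index N M h' a' b' p' q'"
    and "a < a' \<Longrightarrow> cell_index N M h a b p q < cell_index N M h a' b' p' q'"
    and "b < b' \<Longrightarrow> cell_index N M h a b p q < cell_index N M h a b' p' q'"
proof -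
  show "h < h' \<Longrightarrow> cell_index N M h a b p q < cell_index N M h' a' b' p' q'"
    unfolding cell_index_def using assms by (intro pair_less)
  show "a < a' \<Longrightarrow> cell_index N M h a b p q < cell_index N M h a' b' p' q'"
    unfolding cell_index_def using assms by (rule_tac pair_less, rule_tac pair_less, rule_tac pair_less) simp_all
  show "b < b' \<Longrightarrow> cell_index N M h a b p q < cell_index N M h a b' p' q'"
    unfolding cell_index_def using assms by (rule_tac pair_less, rule_tac pair_less) simp_all
qed

lemma cell_index_top: "cell_index N M H 0 0 0 0 = H * N * N * (M * M)"
  by (simp add: cell_index_def)

lemma cell_index_ge_top: "H \<le> h \<Longrightarrow> H * N * N * (M * M) \<le> cell_index N M h a b p q"
  unfolding cell_index_top[symmetric] cell_index_def by (intro add_mono mult_le_mono order_refl le0)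

text \<open>
  Adding one to the index, with a carry out of the last, the last two, \<dots> digits.
\<close>

lemma cell_index_carry:
  "cell_index N M h a b p (Suc q) = Suc (cell_index N M h a b p q)"
  "Suc q = M \<Longrightarrow> cell_index N M h a b (Suc p) 0 = Suc (cell_index N M h a b p q)"
  "Suc q = M \<Longrightarrow> Suc p = M \<Longrightarrow> cell_index N M h a (Suc b) 0 0 = Suc (cell_index N M h a b p q)"
  "Suc q = M \<Longrightarrow> Suc p = M \<Longrightarrow> Suc b = N \<Longrightarrow> cell_index N M h (Suc a) 0 0 0 = Suc (cell_index N M h a b p q)"
  "Suc q = M \<Longrightarrow> Suc p = M \<Longrightarrow> Suc b = N \<Longrightarrow> Suc a = N \<Longrightarrow>
    cell_index N M (Suc h) 0 0 0 0 = Suc (cell_index N M h a b p q)"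
proof -
  have carry: "Suc y = N \<Longrightarrow> Suc x * N + 0 = Suc (x * N + y)" for x y N :: nat by simp
  show "cell_index N M h a b p (Suc q) = Suc (cell_index N M h a b p q)" by (simp add: cell_index_def)
  show "cell_index N M h a b (Suc p) 0 = Suc (cell_index N M h a b p q)" if q: "Suc q = M"
    unfolding cell_index_def by (simp only: carry[OF q] add_Suc_right)
  show "cell_index N M h a (Suc b) 0 0 = Suc (cell_index N M h a b p q)" if q: "Suc q = M" and p: "Suc p = M"
  proof -
    have "p = q" using p q by simp
    then show ?thesis unfolding cell_index_def by (simp only: carry[OF q] add_Suc_right)
  qed
  show "cell_index N M h (Suc a) 0 0 0 = Suc (cell_index N M h a b p q)"
    if q: "Suc q = M" and p: "Suc p = M" and b: "Suc b = N"
  proof -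
    have "p = q" using p q by simp
    then show ?thesis unfolding cell_index_def by (simp only: carry[OF q] carry[OF b] add_Suc_right)
  qed
  show "cell_index N M (Suc h) 0 0 0 0 = Suc (cell_index N M h a b p q)"
    if q: "Suc q = M" and p: "Suc p = M" and b: "Suc b = N" and a: "Suc a = N"
  proof -
    have "p = q" "a = b" using p q a b by simp_all
    then show ?thesis unfolding cell_index_def by (simp only: carry[OF q] carry[OF b] add_Suc_right)
  qed
qed

definition cell_index_exp :: "nexp \<Rightarrow> nexp \<Rightarrow> nexp \<Rightarrow> nexp \<Rightarrow> nexp \<Rightarrow> nexp" where
  "cell_index_exp h a b p q = NAdd (NMul (NAdd (NMul (NAdd (NMul (NAdd (NMul h (NVar ''N'')) a) (NVar ''N'')) b)
     (NVar ''M'')) p) (NVar ''M'')) q"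

lemma nval_cell_index_exp [simp]:
  "nval (cell_index_exp h a b p q) s =
    cell_index (nvar s ''N'') (nvar s ''M'') (nval h s) (nval a s) (nval b s) (nval p s) (nval q s)"
  by (simp add: cell_index_exp_def cell_index_def)

text \<open>
  The current candidate is kept in the variables \<open>bc\<close> (code) and \<open>bv\<close> (value); the arrays \<open>ch\<close> and
  \<open>val\<close> hold the finished cells. The Boolean connectives evaluate all operands, so the cell at \<open>ix\<close> is read
  even if the guard \<open>g\<close> fails; its content is then ignored.
\<close>

definition relaxC :: "nat \<Rightarrow> bexp \<Rightarrow> nexp \<Rightarrow> rexp \<Rightarrow> com" where
  "relaxC code g ix w =
     If (BAnd g (BAnd (NLess (NConst 0) (NArr ''ch'' ix))
       (BNot (BAnd (NLess (NConst 0) (NVar ''bc''))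
         (BNot (RLess (RVar ''bv'') (RAdd (RArr ''val'' ix) w)))))))
      (Seq (RAssign ''bv'' (RAdd (RArr ''val'' ix) w)) (NAssign ''bc'' (NConst code)))
      Skip"

lemma relaxC_simps [simp]:
  "loopfree (relaxC code g ix w)" "nmods (relaxC code g ix w) = {''bc''}"
  "amods (relaxC code g ix w) = {}" "rmods (relaxC code g ix w) = {}"
  by (auto simp: relaxC_def)

lemma effect_relaxC:
  assumes "cand = (if bval g s then (narr s ''ch'' (nval ix s), rarr s ''val'' (nval ix s)) else (0, 0))"
    and "w' = rval w s" and "x = (nvar s ''bc'', rvar s ''bv'')"
  shows "effect (relaxC code g ix w) s =
    s\<lparr>nvar := (nvar s)(''bc'' := fst (relax code w' cand x)), rvar := (rvar s)(''bv'' := snd (relax code w' cand x))\<rparr>"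
  unfolding assms by (auto simp: relaxC_def relax_def)

definition cellC :: com where
  "cellC =
     Seq (NAssign ''k'' (NSub (NVar ''n'') (NVar ''h'')))
    (Seq (If (BAnd (NEq (NVar ''k'') (NVar ''b''))
            (NEq (NAdd (NVar ''p'') (NVar ''q''))
              (NAdd (NMul (NVar ''k'') (NVar ''k'')) (NMul (NConst 2) (NVar ''m'')))))
          (NAssign ''bc'' (NConst 1)) (NAssign ''bc'' (NConst 0)))
    (Seq (RAssign ''bv'' (RConst 0))
    (Seq (relaxC 2 (NLess (NVar ''k'') (NVar ''a''))
            (cell_index_exp (NVar ''h'') (NSub (NVar ''a'') (NConst 1)) (NVar ''b'') (NVar ''p'') (NVar ''q''))
            (RConst 0))
    (Seq (relaxC 3 (NLess (NVar ''k'') (NVar ''b''))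
            (cell_index_exp (NVar ''h'') (NVar ''a'') (NSub (NVar ''b'') (NConst 1)) (NVar ''p'') (NVar ''q''))
            (RArr ''f'' (NVar ''k'')))
    (Seq (relaxC 4
            (BAnd (NLess (NVar ''k'') (NVar ''b''))
            (BAnd (NLess (NVar ''k'') (NVar ''a''))
            (BAnd (BNot (NLess (NMul (NConst 2) (NVar ''m'')) (NAdd (NVar ''p'') (NVar ''a''))))
            (BAnd (BNot (NLess (NMul (NConst 2) (NVar ''m'')) (NAdd (NVar ''q'') (NVar ''b''))))
                  (NLess (NAdd (NAdd (NVar ''p'') (NVar ''a'')) (NVar ''k''))
                    (NAdd (NVar ''q'') (NVar ''b'')))))))
            (cell_index_exp (NSub (NVar ''h'') (NConst 1)) (NVar ''a'') (NVar ''b'')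
              (NAdd (NVar ''p'') (NVar ''a'')) (NAdd (NVar ''q'') (NVar ''b'')))
            (RArr ''f'' (NVar ''a'')))
    (Seq (NStore ''ch'' (cell_index_exp (NVar ''h'') (NVar ''a'') (NVar ''b'') (NVar ''p'') (NVar ''q'')) (NVar ''bc''))
         (RStore ''val'' (cell_index_exp (NVar ''h'') (NVar ''a'') (NVar ''b'') (NVar ''p'') (NVar ''q'')) (RVar ''bv''))))))))"

lemma cellC_simps [simp]:
  "loopfree cellC" "nmods cellC = {''k'', ''bc''}" "amods cellC = {''ch''}" "rmods cellC = {''val''}"
  by (auto simp: cellC_def)

text \<open>
  The radices of the index are \<open>N = n + 1\<close> for \<open>a\<close> and \<open>b\<close>, and \<open>M = 2 * m + 1\<close> for \<open>p\<close> and
  \<open>q\<close>.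
\<close>

definition instance_state :: "nat \<Rightarrow> nat \<Rightarrow> (nat \<Rightarrow> real) \<Rightarrow> state \<Rightarrow> bool" where
  "instance_state n m f s \<longleftrightarrow> nvar s ''n'' = n \<and> nvar s ''m'' = m \<and> nvar s ''N'' = Suc n \<and>
     nvar s ''M'' = Suc (2 * m) \<and> rarr s ''f'' = f"

definition at_digits :: "nat \<Rightarrow> nat \<Rightarrow> nat \<Rightarrow> nat \<Rightarrow> nat \<Rightarrow> state \<Rightarrow> bool" where
  "at_digits h a b p q s \<longleftrightarrow> nvar s ''h'' = h \<and> nvar s ''a'' = a \<and> nvar s ''b'' = b \<and>
     nvar s ''p'' = p \<and> nvar s ''q'' = q"

definition table_upto :: "nat \<Rightarrow> nat \<Rightarrow> (nat \<Rightarrow> real) \<Rightarrow> nat \<Rightarrow> state \<Rightarrow> bool" where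
  "table_upto n m f x s \<longleftrightarrow> (\<forall>h a b p q. h \<le> n \<longrightarrow> a \<le> n \<longrightarrow> b \<le> n \<longrightarrow> p \<le> 2 * m \<longrightarrow> q \<le> 2 * m \<longrightarrow>
     cell_index (Suc n) (Suc (2 * m)) h a b p q < x \<longrightarrow>
     (narr s ''ch'' (cell_index (Suc n) (Suc (2 * m)) h a b p q), rarr s ''val'' (cell_index (Suc n) (Suc (2 * m)) h a b p q))
       = best m f (n - h) a b p q)"

text \<open>
  All cells that the new one depends on have smaller indices, so they already hold their final contents, and
  the successive candidates are the subterms of the recursion for \<open>best\<close>, from the inside out.
\<close>

lemma effect_cellC:
  assumes inst: "instance_state n m f s" and dig: "at_digits h a b p q s"
    and box: "h \<le> n" "a \<le> n" "b \<le> n" "p \<le> 2 * m" "q \<le> 2 * m"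
    and x: "x = cell_index (Suc n) (Suc (2 * m)) h a b p q" and tab: "table_upto n m f x s"
  shows "narr (effect cellC s) ''ch'' = (narr s ''ch'')(x := fst (best m f (n - h) a b p q))"
    and "rarr (effect cellC s) ''val'' = (rarr s ''val'')(x := snd (best m f (n - h) a b p q))"
proof -
  let ?k = "n - h"
  let ?cell_index = "cell_index (Suc n) (Suc (2 * m))"
  let ?cell = "\<lambda>y. (narr s ''ch'' y, rarr s ''val'' y)"
  let ?c1 = "if ?k = b \<and> p + q = ?k * ?k + 2 * m then (1, 0) else (0, 0 :: real)"
  let ?c2 = "relax 2 0 (if ?k < a then ?cell (?cell_index h (a - 1) b p q) else (0, 0)) ?c1"
  let ?c3 = "relax 3 (f ?k) (if ?k < b then ?cell (?cell_index h a (b - 1) p q) else (0, 0)) ?c2"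
  let ?c4 = "relax 4 (f a) (if ?k < b \<and> ?k < a \<and> p + a \<le> 2 * m \<and> q + b \<le> 2 * m \<and> p + a + Suc ?k \<le> q + b
    then ?cell (?cell_index (h - 1) a b (p + a) (q + b)) else (0, 0)) ?c3"
  have cell: "?cell (?cell_index h' a' b' p' q') = best m f (n - h') a' b' p' q'"
    if "h' \<le> n" "a' \<le> n" "b' \<le> n" "p' \<le> 2 * m" "q' \<le> 2 * m" "?cell_index h' a' b' p' q' < x" for h' a' b' p' q'
    using tab that by (auto simp: table_upto_def)
  have "?c4 = best m f ?k a b p q"
  proof -
    have "?k < a \<Longrightarrow> ?cell (?cell_index h (a - 1) b p q) = best m f ?k (a - 1) b p q"
      using box unfolding x[symmetric] by (intro cell) (auto simp: x intro!: cell_index_less(2))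
    moreover have "?k < b \<Longrightarrow> ?cell (?cell_index h a (b - 1) p q) = best m f ?k a (b - 1) p q"
      using box by (intro cell) (auto simp: x intro!: cell_index_less(3))
    moreover have "?cell (?cell_index (h - 1) a b (p + a) (q + b)) = best m f (Suc ?k) a b (p + a) (q + b)"
      if "?k < b" "p + a \<le> 2 * m" "q + b \<le> 2 * m"
    proof -
      have h: "0 < h" using that(1) box by simp
      then have "?cell (?cell_index (h - 1) a b (p + a) (q + b)) = best m f (n - (h - 1)) a b (p + a) (q + b)"
        using box that by (intro cell) (auto simp: x intro!: cell_index_less(1))
      moreover have "n - (h - 1) = Suc ?k" using h box by simp
      ultimately show ?thesis by (simp only:)
    qed
    ultimately show ?thesis
      by (subst best.simps) (simp cong: if_cong conj_cong)
  qed
  moreover have "narr (effect cellC s) ''ch'' = (narr s ''ch'')(x := fst ?c4) \<and>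
      rarr (effect cellC s) ''val'' = (rarr s ''val'')(x := snd ?c4)"
  proof -
    note d = inst[unfolded instance_state_def] dig[unfolded at_digits_def]
    \<comment> \<open>Up to the store at the end, only the current candidate \<open>y\<close> changes.\<close>
    define st where "st y = s\<lparr>nvar := (nvar s)(''k'' := ?k, ''bc'' := fst y), rvar := (rvar s)(''bv'' := snd y)\<rparr>"
      for y :: "nat \<times> real"
    have st_relax: "effect (relaxC code g ix w) (st y) = st (relax code w' cand y)"
      if "cand = (if bval g (st y) then ?cell (nval ix (st y)) else (0, 0))" "w' = rval w (st y)"
      for code g ix w w' cand y
      by (subst effect_relaxC[where cand = cand and w' = w' and x = y]) (use that in \<open>auto simp: st_def\<close>)
    have st_vals: "nvar (st y) ''n'' = n" "nvar (st y) ''m'' = m" "nvar (st y) ''N'' = Suc n"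
      "nvar (st y) ''M'' = Suc (2 * m)" "nvar (st y) ''k'' = ?k" "nvar (st y) ''h'' = h" "nvar (st y) ''a'' = a"
      "nvar (st y) ''b'' = b" "nvar (st y) ''p'' = p" "nvar (st y) ''q'' = q" "rarr (st y) = rarr s"
      "narr (st y) = narr s" "rarr s ''f'' = f" "nvar (st y) ''bc'' = fst y" "rvar (st y) ''bv'' = snd y" for y
      using d by (simp_all add: st_def)
    have le: "u + v + w < z \<longleftrightarrow> u + v + Suc w \<le> z" for u v w z :: nat by auto
    have init: "effect (RAssign ''bv'' (RConst 0)) (effect (If (BAnd (NEq (NVar ''k'') (NVar ''b''))
            (NEq (NAdd (NVar ''p'') (NVar ''q''))
              (NAdd (NMul (NVar ''k'') (NVar ''k'')) (NMul (NConst 2) (NVar ''m'')))))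
          (NAssign ''bc'' (NConst 1)) (NAssign ''bc'' (NConst 0)))
        (effect (NAssign ''k'' (NSub (NVar ''n'') (NVar ''h''))) s)) = st ?c1"
      using d by (simp add: st_def)
    have r2: "effect (relaxC 2 (NLess (NVar ''k'') (NVar ''a''))
            (cell_index_exp (NVar ''h'') (NSub (NVar ''a'') (NConst 1)) (NVar ''b'') (NVar ''p'') (NVar ''q''))
            (RConst 0)) (st ?c1) = st ?c2"
      by (rule st_relax) (simp_all add: st_vals)
    have r3: "effect (relaxC 3 (NLess (NVar ''k'') (NVar ''b''))
            (cell_index_exp (NVar ''h'') (NVar ''a'') (NSub (NVar ''b'') (NConst 1)) (NVar ''p'') (NVar ''q''))
            (RArr ''f'' (NVar ''k''))) (st ?c2) = st ?c3"
      by (rule st_relax) (simp_all add: st_vals)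
    have r4: "effect (relaxC 4
            (BAnd (NLess (NVar ''k'') (NVar ''b''))
            (BAnd (NLess (NVar ''k'') (NVar ''a''))
            (BAnd (BNot (NLess (NMul (NConst 2) (NVar ''m'')) (NAdd (NVar ''p'') (NVar ''a''))))
            (BAnd (BNot (NLess (NMul (NConst 2) (NVar ''m'')) (NAdd (NVar ''q'') (NVar ''b''))))
                  (NLess (NAdd (NAdd (NVar ''p'') (NVar ''a'')) (NVar ''k''))
                    (NAdd (NVar ''q'') (NVar ''b'')))))))
            (cell_index_exp (NSub (NVar ''h'') (NConst 1)) (NVar ''a'') (NVar ''b'')
              (NAdd (NVar ''p'') (NVar ''a'')) (NAdd (NVar ''q'') (NVar ''b'')))
            (RArr ''f'' (NVar ''a''))) (st ?c3) = st ?c4"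
      by (rule st_relax) (simp_all add: st_vals not_less le)
    show ?thesis
      unfolding cellC_def effect.simps(6) init r2 r3 r4
      by (simp only: effect.simps nval_cell_index_exp) (simp add: st_vals x)
  qed
  ultimately show "narr (effect cellC s) ''ch'' = (narr s ''ch'')(x := fst (best m f (n - h) a b p q))"
    and "rarr (effect cellC s) ''val'' = (rarr s ''val'')(x := snd (best m f (n - h) a b p q))"
    by simp_all
qed

text \<open>
  The five digits are kept in separate variables and counted up like an odometer, since the machine has no
  division that would recover them from the index.
\<close>

definition odometerC :: com where
  "odometerC =
    Seq (NAssign ''q'' (NAdd (NVar ''q'') (NConst 1)))
    (If (NLess (NVar ''q'') (NVar ''M'')) Skip
      (Seq (NAssign ''q'' (NConst 0)) (Seq (NAssign ''p'' (NAdd (NVar ''p'') (NConst 1)))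
      (If (NLess (NVar ''p'') (NVar ''M'')) Skip
        (Seq (NAssign ''p'' (NConst 0)) (Seq (NAssign ''b'' (NAdd (NVar ''b'') (NConst 1)))
        (If (NLess (NVar ''b'') (NVar ''N'')) Skip
          (Seq (NAssign ''b'' (NConst 0)) (Seq (NAssign ''a'' (NAdd (NVar ''a'') (NConst 1)))
          (If (NLess (NVar ''a'') (NVar ''N'')) Skip
            (Seq (NAssign ''a'' (NConst 0)) (NAssign ''h'' (NAdd (NVar ''h'') (NConst 1))))))))))))))"

lemma odometerC_simps [simp]:
  "loopfree odometerC" "nmods odometerC = {''h'', ''a'', ''b'', ''p'', ''q''}" "amods odometerC = {}" "rmods odometerC = {}"
  by (auto simp: odometerC_def)

lemma effect_odometerC:
  assumes inst: "instance_state n m f s" and dig: "at_digits h a b p q s"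
    and box: "a \<le> n" "b \<le> n" "p \<le> 2 * m" "q \<le> 2 * m"
  obtains h' a' b' p' q' where "at_digits h' a' b' p' q' (effect odometerC s)"
    "a' \<le> n" "b' \<le> n" "p' \<le> 2 * m" "q' \<le> 2 * m"
    "cell_index (Suc n) (Suc (2 * m)) h' a' b' p' q' = Suc (cell_index (Suc n) (Suc (2 * m)) h a b p q)"
proof -
  note d = inst[unfolded instance_state_def] dig[unfolded at_digits_def]
  consider "q < 2 * m" | "q = 2 * m" "p < 2 * m" | "q = 2 * m" "p = 2 * m" "b < n"
    | "q = 2 * m" "p = 2 * m" "b = n" "a < n" | "q = 2 * m" "p = 2 * m" "b = n" "a = n"
    using box by linarith
  then show ?thesis
  proof cases
    case 1
    then show ?thesis using d box
      by (intro that[of h a b p "Suc q"] cell_index_carry) (simp_all add: odometerC_def at_digits_def)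
  next
    case 2
    then show ?thesis using d box
      by (intro that[of h a b "Suc p" 0] cell_index_carry) (simp_all add: odometerC_def at_digits_def)
  next
    case 3
    then show ?thesis using d box
      by (intro that[of h a "Suc b" 0 0] cell_index_carry) (simp_all add: odometerC_def at_digits_def)
  next
    case 4
    then show ?thesis using d box
      by (intro that[of h "Suc a" 0 0 0] cell_index_carry) (simp_all add: odometerC_def at_digits_def)
  next
    case 5
    then show ?thesis using d box
      by (intro that[of "Suc h" 0 0 0 0] cell_index_carry) (simp_all add: odometerC_def at_digits_def)
  qed
qed

definition tableC :: com where
  "tableC = For ''x'' (NMul (NMul (NMul (NVar ''N'') (NVar ''N'')) (NVar ''N'')) (NMul (NVar ''M'') (NVar ''M'')))
     (Seq cellC odometerC)"

lemma tableC_mods [simp]: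
  "nmods tableC = {''x'', ''k'', ''bc'', ''h'', ''a'', ''b'', ''p'', ''q''}"
  "amods tableC = {''ch''}" "rmods tableC = {''val''}"
  by (auto simp: tableC_def)

lemma runs_tableC:
  assumes inst: "instance_state n m f s0" and dig: "at_digits 0 0 0 0 0 s0"
    and T: "(Suc n * Suc n * Suc n * (Suc (2 * m) * Suc (2 * m)) + 1) * (max_time cellC + max_time odometerC + 9 + 9) \<le> T"
  shows "runs tableC s0 T (\<lambda>s. table_upto n m f (Suc n * Suc n * Suc n * (Suc (2 * m) * Suc (2 * m))) s)"
    (is "runs tableC s0 T (\<lambda>s. table_upto n m f ?H s)")
proof -
  let ?cell_index = "cell_index (Suc n) (Suc (2 * m))"
  define I where "I x s \<longleftrightarrow> table_upto n m f x s \<and> (\<exists>h a b p q. at_digits h a b p q s \<and>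
    a \<le> n \<and> b \<le> n \<and> p \<le> 2 * m \<and> q \<le> 2 * m \<and> ?cell_index h a b p q = x)" for x s
  show ?thesis unfolding tableC_def
  proof (rule runs_For[where I = I and H = ?H and T = "max_time cellC + max_time odometerC"])
    have "at_digits 0 0 0 0 0 (s0\<lparr>nvar := (nvar s0)(''x'' := 0)\<rparr>)" using dig by (simp add: at_digits_def)
    moreover have "?cell_index 0 0 0 0 0 = 0" by (simp add: cell_index_def)
    ultimately show "I 0 (s0\<lparr>nvar := (nvar s0)(''x'' := 0)\<rparr>)" unfolding I_def
      by (fastforce simp: table_upto_def)
  next
    fix x s
    assume x: "x < ?H" and I: "I x s" and "nvar s ''x'' = x"
      and fr: "frame (For ''x'' (NMul (NMul (NMul (NVar ''N'') (NVar ''N'')) (NVar ''N'')) (NMul (NVar ''M'') (NVar ''M'')))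
        (Seq cellC odometerC)) s0 s"
    obtain h a b p q where dg: "at_digits h a b p q s" and box: "a \<le> n" "b \<le> n" "p \<le> 2 * m" "q \<le> 2 * m"
      and cell_index: "?cell_index h a b p q = x" and tab: "table_upto n m f x s" using I by (auto simp: I_def)
    have inst_s: "instance_state n m f s" using inst fr by (simp add: instance_state_def frame_def)
    have "h < Suc n"
    proof (rule ccontr)
      assume "\<not> h < Suc n"
      then have "Suc n \<le> h" by simp
      then show False using x cell_index_ge_top[of "Suc n" h "Suc n" "Suc (2 * m)" a b p q]
        unfolding cell_index by (metis leD)
    qed
    then have h: "h \<le> n" by simp
    let ?s1 = "effect cellC s"
    note cell = effect_cellC[OF inst_s dg h box cell_index[symmetric] tab]
    have fr1: "frame cellC s ?s1" by (rule effect_frame) simp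
    have is1: "instance_state n m f ?s1" and dg1: "at_digits h a b p q ?s1"
      using inst_s dg fr1 by (simp_all add: instance_state_def at_digits_def frame_def)
    have tab1: "table_upto n m f (Suc x) ?s1"
      unfolding table_upto_def
    proof (intro allI impI)
      fix h' a' b' p' q'
      assume box': "h' \<le> n" "a' \<le> n" "b' \<le> n" "p' \<le> 2 * m" "q' \<le> 2 * m"
        and less: "?cell_index h' a' b' p' q' < Suc x"
      show "(narr ?s1 ''ch'' (?cell_index h' a' b' p' q'), rarr ?s1 ''val'' (?cell_index h' a' b' p' q')) =
          best m f (n - h') a' b' p' q'"
      proof (cases "?cell_index h' a' b' p' q' = x")
        case True
        then have "h' = h" "a' = a" "b' = b" "p' = p" "q' = q"
          using cell_index_eq[of a' "Suc n" a b' b p' "Suc (2 * m)" p q' q h' h] box box' cell_index by auto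
        then show ?thesis using True by (simp add: cell)
      next
        case False
        then show ?thesis using tab box' less by (simp add: cell table_upto_def)
      qed
    qed
    obtain h' a' b' p' q' where odo: "at_digits h' a' b' p' q' (effect odometerC ?s1)"
      "a' \<le> n" "b' \<le> n" "p' \<le> 2 * m" "q' \<le> 2 * m" "?cell_index h' a' b' p' q' = Suc x"
      using effect_odometerC[OF is1 dg1 box] cell_index by metis
    have fr2: "frame odometerC ?s1 (effect odometerC ?s1)" by (rule effect_frame) simp
    have "table_upto n m f (Suc x) (effect odometerC ?s1)"
      using tab1 fr2 by (simp add: table_upto_def frame_def)
    then have "I (Suc x) ((effect odometerC ?s1)\<lparr>nvar := (nvar (effect odometerC ?s1))(''x'' := Suc x)\<rparr>)"
      unfolding I_def using odo by (fastforce simp: table_upto_def at_digits_def)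
    then show "runs (Seq cellC odometerC) s (max_time cellC + max_time odometerC)
        (\<lambda>s'. I (Suc x) (s'\<lparr>nvar := (nvar s')(''x'' := Suc x)\<rparr>))"
      by (intro runs_loopfree) simp_all
  next
    fix s
    assume "frame (For ''x'' (NMul (NMul (NMul (NVar ''N'') (NVar ''N'')) (NVar ''N'')) (NMul (NVar ''M'') (NVar ''M'')))
        (Seq cellC odometerC)) s0 s"
    then show "nval (NMul (NMul (NMul (NVar ''N'') (NVar ''N'')) (NVar ''N'')) (NMul (NVar ''M'') (NVar ''M''))) s = ?H"
      using inst by (simp add: instance_state_def frame_def)
  next
    have "ncost (NMul (NMul (NMul (NVar ''N'') (NVar ''N'')) (NVar ''N'')) (NMul (NVar ''M'') (NVar ''M''))) = 9"
      by simp
    then show "(?H + 1) * (max_time cellC + max_time odometerC +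
        ncost (NMul (NMul (NMul (NVar ''N'') (NVar ''N'')) (NVar ''N'')) (NMul (NVar ''M'') (NVar ''M''))) + 9) \<le> T"
      using T by (simp only:)
  qed (simp_all add: I_def)
qed

section \<open>Reading an optimal sequence off the table\<close>

definition current_index_exp :: nexp where
  "current_index_exp = cell_index_exp (NVar ''h'') (NVar ''a'') (NVar ''b'') (NVar ''p'') (NVar ''q'')"

definition stepC :: com where
  "stepC =
    If (NEq (NArr ''ch'' current_index_exp) (NConst 2)) (NAssign ''a'' (NSub (NVar ''a'') (NConst 1)))
   (If (NEq (NArr ''ch'' current_index_exp) (NConst 3))
      (Seq (NStore ''d'' (NVar ''b'') (NSub (NVar ''n'') (NVar ''h'')))
           (NAssign ''b'' (NSub (NVar ''b'') (NConst 1))))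
      (Seq (NStore ''d'' (NAdd (NSub (NVar ''n'') (NVar ''h'')) (NConst 1)) (NVar ''a''))
      (Seq (NAssign ''p'' (NAdd (NVar ''p'') (NVar ''a'')))
      (Seq (NAssign ''q'' (NAdd (NVar ''q'') (NVar ''b'')))
           (NAssign ''h'' (NSub (NVar ''h'') (NConst 1)))))))"

lemma stepC_simps [simp]: "loopfree stepC"
  by (simp add: stepC_def)

definition walkC :: com where
  "walkC = While (BNot (NEq (NArr ''ch'' current_index_exp) (NConst 1))) stepC"

lemma walkC_mods [simp]:
  "nmods walkC = {''h'', ''a'', ''b'', ''p'', ''q''}" "amods walkC = {''d''}" "rmods walkC = {}"
  by (auto simp: walkC_def stepC_def)

lemma table_full:
  assumes "table_upto n m f (Suc n * Suc n * Suc n * (Suc (2 * m) * Suc (2 * m))) s"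
    and "h \<le> n" "a \<le> n" "b \<le> n" "p \<le> 2 * m" "q \<le> 2 * m"
  shows "narr s ''ch'' (cell_index (Suc n) (Suc (2 * m)) h a b p q) = fst (best m f (n - h) a b p q)"
proof -
  have "cell_index (Suc n) (Suc (2 * m)) h a b p q < cell_index (Suc n) (Suc (2 * m)) (Suc n) 0 0 0 0"
    using assms(2-) by (intro cell_index_less(1)) auto
  also have "\<dots> = Suc n * Suc n * Suc n * (Suc (2 * m) * Suc (2 * m))" by (rule cell_index_top)
  finally have "cell_index (Suc n) (Suc (2 * m)) h a b p q < Suc n * Suc n * Suc n * (Suc (2 * m) * Suc (2 * m))" .
  with assms show ?thesis unfolding table_upto_def by (metis fst_conv)
qed

text \<open>
  Each step follows the stored move and writes the entry that the move reads into the array \<open>d\<close>. The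
  induction is on the quantity that decreases along a walk. Entries outside \<open>{k<..b}\<close> are not touched, so
  what a step writes is still there at the end. The constant \<open>K\<close> is the time of one test and one step.
\<close>

lemma runs_walkC:
  fixes K :: nat
  defines "K \<equiv> 3 + ncost current_index_exp + 1 + max_time stepC + 1"
  assumes inst: "instance_state n m f s" and dig: "at_digits h a b p q s"
    and box: "h \<le> n" "a \<le> n" "b \<le> n" "p \<le> 2 * m" "q \<le> 2 * m"
    and tab: "\<And>h a b p q. h \<le> n \<Longrightarrow> a \<le> n \<Longrightarrow> b \<le> n \<Longrightarrow> p \<le> 2 * m \<Longrightarrow> q \<le> 2 * m \<Longrightarrow>
      narr s ''ch'' (cell_index (Suc n) (Suc (2 * m)) h a b p q) = fst (best m f (n - h) a b p q)"
    and feas: "fst (best m f (n - h) a b p q) \<noteq> 0"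
  shows "runs walkC s ((b - (n - h) + a + b + 1) * K) (\<lambda>s'.
    completion m (n - h) a b p q (narr s' ''d'') \<and>
    (\<Sum>i\<in>{n - h<..b}. f (narr s' ''d'' i)) = snd (best m f (n - h) a b p q) \<and>
    (\<forall>i. i \<le> n - h \<or> b < i \<longrightarrow> narr s' ''d'' i = narr s ''d'' i))"
  using inst dig box tab feas
proof (induction "b - (n - h) + a + b" arbitrary: h a b p q s rule: less_induct)
  case less
  let ?k = "n - h" and ?b = "BNot (NEq (NArr ''ch'' current_index_exp) (NConst 1))"
  let ?B = "best m f ?k a b p q"
  let ?Q = "\<lambda>s'. completion m ?k a b p q (narr s' ''d'') \<and>
    (\<Sum>i\<in>{?k<..b}. f (narr s' ''d'' i)) = snd ?B \<and>
    (\<forall>i. i \<le> ?k \<or> b < i \<longrightarrow> narr s' ''d'' i = narr s ''d'' i)"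
  note inst = less.prems(1)[unfolded instance_state_def] and dig = less.prems(2)[unfolded at_digits_def]
  have cur: "narr s ''ch'' (nval current_index_exp s) = fst ?B"
    using inst dig less.prems(3-8) by (simp add: current_index_exp_def)
  have loop: "runs walkC s ((b - ?k + a + b + 1) * K) ?Q"
    if code: "fst ?B \<noteq> 1" and smaller: "b' - (n - h') + a' + b' < b - ?k + a + b"
      and box': "h' \<le> n" "a' \<le> n" "b' \<le> n" "p' \<le> 2 * m" "q' \<le> 2 * m"
      and s': "instance_state n m f s'" "at_digits h' a' b' p' q' s'" "narr s' ''ch'' = narr s ''ch''"
      and feas': "fst (best m f (n - h') a' b' p' q') \<noteq> 0"
      and step: "effect stepC s = s'"
      and fin: "\<And>D. completion m (n - h') a' b' p' q' D \<Longrightarrow>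
        (\<Sum>i\<in>{n - h'<..b'}. f (D i)) = snd (best m f (n - h') a' b' p' q') \<Longrightarrow>
        (\<And>i. i \<le> n - h' \<or> b' < i \<Longrightarrow> D i = narr s' ''d'' i) \<Longrightarrow>
        completion m ?k a b p q D \<and> (\<Sum>i\<in>{?k<..b}. f (D i)) = snd ?B \<and>
        (\<forall>i. i \<le> ?k \<or> b < i \<longrightarrow> D i = narr s ''d'' i)"
    for h' a' b' p' q' s'
    unfolding walkC_def
  proof (rule runs_WhileTrue)
    show "bval ?b s" using cur code by simp
    have "runs walkC s' ((b' - (n - h') + a' + b' + 1) * K) (\<lambda>t.
        completion m (n - h') a' b' p' q' (narr t ''d'') \<and>
        (\<Sum>i\<in>{n - h'<..b'}. f (narr t ''d'' i)) = snd (best m f (n - h') a' b' p' q') \<and>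
        (\<forall>i. i \<le> n - h' \<or> b' < i \<longrightarrow> narr t ''d'' i = narr s' ''d'' i))"
      using less.prems(8) s'(3) feas' by (intro less.hyps[OF smaller s'(1,2) box']) simp_all
    then have "runs walkC s' ((b' - (n - h') + a' + b' + 1) * K) ?Q"
      by (rule runs_weaken[OF _ order_refl]) (intro fin, blast+)
    moreover have "(b' - (n - h') + a' + b' + 1) * K \<le> (b - ?k + a + b) * K"
      using smaller by (intro mult_le_mono1) simp
    ultimately have "runs walkC s' ((b - ?k + a + b) * K) ?Q" by (rule runs_weaken) assumption
    then show "runs stepC s (max_time stepC) (\<lambda>s'. runs (While ?b stepC) s' ((b - ?k + a + b) * K) ?Q)"
      using step by - (rule runs_loopfree, simp_all add: walkC_def)
    show "1 + bcost ?b + max_time stepC + (b - ?k + a + b) * K \<le> (b - ?k + a + b + 1) * K"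
      by (simp add: K_def)
  qed
  consider (stop) "fst ?B = 1" "snd ?B = 0" "?k = b" "p + q = ?k * ?k + 2 * m"
    | (lower) "fst ?B = 2" "?k < a" "fst (best m f ?k (a - 1) b p q) \<noteq> 0"
        "snd ?B = snd (best m f ?k (a - 1) b p q)"
    | (right) "fst ?B = 3" "?k < b" "fst (best m f ?k a (b - 1) p q) \<noteq> 0"
        "snd ?B = snd (best m f ?k a (b - 1) p q) + f ?k"
    | (left) "fst ?B = 4" "?k < b" "?k < a" "p + a \<le> 2 * m" "q + b \<le> 2 * m" "p + a + Suc ?k \<le> q + b"
        "fst (best m f (Suc ?k) a b (p + a) (q + b)) \<noteq> 0"
        "snd ?B = snd (best m f (Suc ?k) a b (p + a) (q + b)) + f a"
    using best_step[OF less.prems(9)] by blast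
  then show ?case
  proof cases
    case stop
    have "completion m ?k a b p q (narr s ''d'')"
      unfolding stop(3)[symmetric] by (rule completion.stop[OF stop(4)])
    then show ?thesis unfolding walkC_def
      using cur stop by (intro runs_WhileFalse) (auto simp: K_def)
  next
    case lower
    let ?s = "s\<lparr>nvar := (nvar s)(''a'' := a - 1)\<rparr>"
    have "effect stepC s = ?s" using cur lower dig by (simp add: stepC_def)
    moreover have "instance_state n m f ?s" "at_digits h (a - 1) b p q ?s" "narr ?s ''ch'' = narr s ''ch''"
      using inst dig by (simp_all add: instance_state_def at_digits_def)
    moreover have "fst ?B \<noteq> 1" "b - ?k + (a - 1) + b < b - ?k + a + b" "a - 1 \<le> n"
      using lower(1,2) less.prems(4) by linarith+
    ultimately show ?thesis
      using less.prems(3,5,6,7) lower(2,3,4)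
      by (intro loop[of b h "a - 1" p q ?s]) (simp_all add: completion.lower)
  next
    case right
    let ?s = "s\<lparr>narr := (narr s)(''d'' := (narr s ''d'')(b := ?k)), nvar := (nvar s)(''b'' := b - 1)\<rparr>"
    have step: "effect stepC s = ?s" using cur right dig inst by (simp add: stepC_def)
    have set: "{?k<..b} = insert b {?k<..b - 1}" using right(2) by auto
    have smaller: "b - 1 - ?k + a + (b - 1) < b - ?k + a + b" using right(2) by linarith
    have box': "fst ?B \<noteq> 1" "b - 1 \<le> n" using right(1) less.prems(5) by linarith+
    have state': "instance_state n m f ?s" "at_digits h a (b - 1) p q ?s" "narr ?s ''ch'' = narr s ''ch''"
      using inst dig by (simp_all add: instance_state_def at_digits_def)
    show ?thesis
    proof (rule loop[of "b - 1" h a p q ?s])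
      fix D
      assume D: "completion m ?k a (b - 1) p q D"
        "(\<Sum>i\<in>{?k<..b - 1}. f (D i)) = snd (best m f ?k a (b - 1) p q)"
        "\<And>i. i \<le> ?k \<or> b - 1 < i \<Longrightarrow> D i = narr ?s ''d'' i"
      have Db: "D b = ?k" using D(3)[of b] right(2) by simp
      have "completion m ?k a b p q D" using right(2) Db D(1) by (rule completion.right)
      moreover have "(\<Sum>i\<in>{?k<..b}. f (D i)) = snd ?B"
        unfolding set using right(2) Db D(2) right(4) by (subst sum.insert) auto
      moreover have "D i = narr s ''d'' i" if "i \<le> ?k \<or> b < i" for i
        using D(3)[of i] that right(2) by auto
      ultimately show "completion m ?k a b p q D \<and> (\<Sum>i\<in>{?k<..b}. f (D i)) = snd ?B \<and>
        (\<forall>i. i \<le> ?k \<or> b < i \<longrightarrow> D i = narr s ''d'' i)" by blast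
    qed (rule box' state' smaller step right(3) less.prems(3,4,6,7))+
  next
    case left
    have h: "0 < h" "n - (h - 1) = Suc ?k" using left(2) less.prems(3,5) by auto
    let ?s = "s\<lparr>narr := (narr s)(''d'' := (narr s ''d'')(Suc ?k := a)),
      nvar := (nvar s)(''p'' := p + a, ''q'' := q + b, ''h'' := h - 1)\<rparr>"
    have step: "effect stepC s = ?s" using cur left dig inst by (simp add: stepC_def)
    have set: "{?k<..b} = insert (Suc ?k) {Suc ?k<..b}" using left(2) by auto
    have smaller: "b - (n - (h - 1)) + a + b < b - ?k + a + b" using left(2) h by linarith
    have box': "fst ?B \<noteq> 1" "h - 1 \<le> n" using left(1) less.prems(3) by linarith+
    have state': "instance_state n m f ?s" "at_digits (h - 1) a b (p + a) (q + b) ?s"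
      "narr ?s ''ch'' = narr s ''ch''"
      using inst dig by (simp_all add: instance_state_def at_digits_def)
    have feas': "fst (best m f (n - (h - 1)) a b (p + a) (q + b)) \<noteq> 0" unfolding h(2) by (rule left(7))
    show ?thesis
    proof (rule loop[of b "h - 1" a "p + a" "q + b" ?s])
      fix D
      assume D: "completion m (n - (h - 1)) a b (p + a) (q + b) D"
        "(\<Sum>i\<in>{n - (h - 1)<..b}. f (D i)) = snd (best m f (n - (h - 1)) a b (p + a) (q + b))"
        "\<And>i. i \<le> n - (h - 1) \<or> b < i \<Longrightarrow> D i = narr ?s ''d'' i"
      note D = D[unfolded h(2)]
      have Dk: "D (Suc ?k) = a" using D(3)[of "Suc ?k"] by simp
      have "completion m ?k a b p q D"
        by (rule completion.left[OF left(2-6) Dk D(1)])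
      moreover have "(\<Sum>i\<in>{?k<..b}. f (D i)) = snd ?B"
        unfolding set using Dk D(2) left(8) by (subst sum.insert) auto
      moreover have "D i = narr s ''d'' i" if "i \<le> ?k \<or> b < i" for i
        using D(3)[of i] that left(2) by auto
      ultimately show "completion m ?k a b p q D \<and> (\<Sum>i\<in>{?k<..b}. f (D i)) = snd ?B \<and>
        (\<forall>i. i \<le> ?k \<or> b < i \<longrightarrow> D i = narr s ''d'' i)" by blast
    qed (rule box' state' smaller step feas' left(4,5) less.prems(4,5))+
  qed
qed

section \<open>Building the graph\<close>

text \<open>
  A loop over \<open>0, \<dots>, n\<close> takes at most \<open>n + 2 \<le> 3 * n\<close> rounds, counting the final test. Time bounds of the
  form \<open>n ^ e * K\<close> can thus be passed through nested loops.
\<close>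

lemma runs_For_vertices:
  assumes "I 0 (s0\<lparr>nvar := (nvar s0)(x := 0)\<rparr>)"
    and "\<And>k s. k < Suc n \<Longrightarrow> I k s \<Longrightarrow> nvar s x = k \<Longrightarrow> frame (For x (NVar ''N'') c) s0 s \<Longrightarrow>
      runs c s (n ^ e * K) (\<lambda>s'. I (Suc k) (s'\<lparr>nvar := (nvar s')(x := Suc k)\<rparr>))"
    and "x \<notin> nmods c" "''N'' \<notin> insert x (nmods c)" "nvar s0 ''N'' = Suc n" "1 \<le> n"
    and "\<And>s. I (Suc n) s \<Longrightarrow> frame (For x (NVar ''N'') c) s0 s \<Longrightarrow> Q s"
    and e': "e' = Suc e" and K': "K' = 3 * (K + 10)"
  shows "runs (For x (NVar ''N'') c) s0 (n ^ e' * K') Q"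
proof (rule runs_For[where I = I and H = "Suc n" and T = "n ^ e * K"])
  have "(Suc n + 1) * (n ^ e * K + 10) \<le> (3 * n) * (n ^ e * K + n ^ e * 10)"
    using assms(6) by (intro mult_le_mono) auto
  also have "\<dots> = n ^ e' * K'" by (simp add: e' K' algebra_simps)
  finally have "(Suc n + 1) * (n ^ e * K + 10) \<le> n ^ e' * K'" .
  moreover have "n ^ e * K + ncost (NVar ''N'') + 9 = n ^ e * K + 10" by simp
  ultimately show "(Suc n + 1) * (n ^ e * K + ncost (NVar ''N'') + 9) \<le> n ^ e' * K'" by (simp only:)
next
  fix s assume "frame (For x (NVar ''N'') c) s0 s"
  then show "nval (NVar ''N'') s = Suc n" using assms(4,5) by (simp add: frame_def)
qed (fact assms(1) | erule (3) assms(2) | fact assms(3) | erule (1) assms(7))+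

definition pair_index_exp :: "vname \<Rightarrow> vname \<Rightarrow> nexp" where
  "pair_index_exp x y = NAdd (NMul (NVar x) (NVar ''N'')) (NVar y)"

text \<open>
  The array \<open>g\<close> is the adjacency matrix, linearised with row length \<open>n + 1\<close>; for a simple graph the
  row and the column \<open>0\<close> are zero. The array \<open>c\<close> holds the current degrees.
\<close>

definition represents :: "nat \<Rightarrow> nat set set \<Rightarrow> (nat \<Rightarrow> nat) \<Rightarrow> (nat \<Rightarrow> nat) \<Rightarrow> bool" where
  "represents n E g c \<longleftrightarrow> (\<forall>i\<le>n. \<forall>j\<le>n. g (i * Suc n + j) = of_bool ({i, j} \<in> E)) \<and>
     (\<forall>i\<le>n. c i = degree E i)"

text \<open>
  The effect of the matrix updates on one entry: \<open>A\<close> and \<open>B\<close> say that its position is one of the two that are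
  written.
\<close>

lemma of_bool_insert: "(if B then 1 else if A then 1 else of_bool C) = (of_bool (A \<or> B \<or> C) :: nat)"
  by simp

text \<open>
  Here \<open>A\<close> and \<open>B\<close> stand for the two positions that are erased, and \<open>C\<close> and \<open>D\<close> for the two that are set.
\<close>

lemma of_bool_move: "(if D then 1 else if C then 1 else if B then 0 else if A then 0 else of_bool P) =
    (of_bool (C \<or> D \<or> P \<and> \<not> A \<and> \<not> B) :: nat)"
  by simp

lemma represents_insert:
  assumes rep: "represents n E g c" and fin: "finite E"
    and e: "i \<le> n" "j \<le> n" "i \<noteq> j" "{i, j} \<notin> E"
  shows "represents n (insert {i, j} E) (g(i * Suc n + j := 1, j * Suc n + i := 1)) (c(i := c i + 1, j := c j + 1))"
  unfolding represents_def
proof (intro conjI allI impI)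
  fix x y assume xy: "x \<le> n" "y \<le> n"
  have eq: "x * Suc n + y = i * Suc n + j \<longleftrightarrow> x = i \<and> y = j"
    "x * Suc n + y = j * Suc n + i \<longleftrightarrow> x = j \<and> y = i"
    using xy e by (intro pair_eq; simp)+
  have old: "g (x * Suc n + y) = of_bool ({x, y} \<in> E)" using rep xy by (simp only: represents_def)
  have new: "{x, y} \<in> insert {i, j} E \<longleftrightarrow> x = i \<and> y = j \<or> x = j \<and> y = i \<or> {x, y} \<in> E"
    by (simp add: doubleton_eq_iff)
  show "(g(i * Suc n + j := 1, j * Suc n + i := 1)) (x * Suc n + y) = of_bool ({x, y} \<in> insert {i, j} E)"
    unfolding fun_upd_apply eq old new by (rule of_bool_insert)
next
  fix x assume "x \<le> n"
  then show "(c(i := c i + 1, j := c j + 1)) x = degree (insert {i, j} E) x"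
    using rep e degree_insert[OF fin e(4), of x] by (auto simp: represents_def)
qed

lemma represents_move:
  assumes rep: "represents n E g c" and G: "simple_graph n E"
    and j: "1 \<le> j" "j \<le> n" "i \<noteq> j" and mv: "movable i j w E"
  shows "represents n (move_edge i j w E)
    (g(i * Suc n + w := 0, w * Suc n + i := 0, j * Suc n + w := 1, w * Suc n + j := 1))
    (c(i := c i - 1, j := c j + 1))"
  unfolding represents_def
proof (intro conjI allI impI)
  have iw: "i \<noteq> w" "i \<le> n" "w \<le> n" "w \<noteq> j"
    using simple_graph_edge[OF G, of i w] mv by (auto simp: movable_def)
  {
    fix x y assume xy: "x \<le> n" "y \<le> n"
    have eq: "x * Suc n + y = i * Suc n + w \<longleftrightarrow> x = i \<and> y = w"
      "x * Suc n + y = w * Suc n + i \<longleftrightarrow> x = w \<and> y = i"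
      "x * Suc n + y = j * Suc n + w \<longleftrightarrow> x = j \<and> y = w"
      "x * Suc n + y = w * Suc n + j \<longleftrightarrow> x = w \<and> y = j"
      using xy iw j by (intro pair_eq; simp)+
    have old: "g (x * Suc n + y) = of_bool ({x, y} \<in> E)" using rep xy by (simp only: represents_def)
    have new: "{x, y} \<in> move_edge i j w E \<longleftrightarrow> x = j \<and> y = w \<or> x = w \<and> y = j \<or>
        {x, y} \<in> E \<and> \<not> (x = i \<and> y = w) \<and> \<not> (x = w \<and> y = i)"
      by (auto simp: move_edge_def doubleton_eq_iff)
    show "(g(i * Suc n + w := 0, w * Suc n + i := 0, j * Suc n + w := 1, w * Suc n + j := 1)) (x * Suc n + y)
        = of_bool ({x, y} \<in> move_edge i j w E)"
      unfolding fun_upd_apply eq old new by (rule of_bool_move)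
  next
    fix x assume "x \<le> n"
    then show "(c(i := c i - 1, j := c j + 1)) x = degree (move_edge i j w E) x"
      using rep j iw move_edge(3)[OF G j mv, of x] move_edge(3)[OF G j mv, of i]
      by (auto simp: represents_def)
  }
qed

lemma staircase_row_end: "staircase n d i (Suc n) = staircase n d (Suc i) 0"
  unfolding staircase_def by (intro Collect_cong iff_exI conj_cong refl) auto

lemma staircase_step:
  "staircase n d i (Suc j) =
    (if 1 \<le> i \<and> i < j \<and> j \<le> n \<and> i \<le> d j then insert {i, j} (staircase n d i j) else staircase n d i j)"
proof -
  have "staircase n d i (Suc j) =
      staircase n d i j \<union> {{x, y} |x y. x = i \<and> y = j \<and> 1 \<le> x \<and> x < y \<and> y \<le> n \<and> x \<le> d y}"
    unfolding staircase_def less_Suc_eq by blast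
  then show ?thesis by auto
qed

text \<open>
  As long as fewer than \<open>m\<close> edges have been found, the graph is the staircase up to the current pair; once there
  are \<open>m\<close>, it stays what it is.
\<close>

definition staircase_prefix :: "nat \<Rightarrow> nat \<Rightarrow> (nat \<Rightarrow> nat) \<Rightarrow> nat \<Rightarrow> nat \<Rightarrow> nat set set \<Rightarrow> bool" where
  "staircase_prefix n m d i j E \<longleftrightarrow> card E \<le> m \<and>
     (E = staircase n d i j \<or> card E = m \<and> (\<exists>i0 j0. E = staircase n d i0 j0))"

definition addC :: com where
  "addC =
    If (BAnd (NLess (NConst 0) (NVar ''i'')) (BAnd (NLess (NVar ''i'') (NVar ''j''))
       (BAnd (BNot (NLess (NArr ''d'' (NVar ''j'')) (NVar ''i''))) (NLess (NVar ''e'') (NVar ''m'')))))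
      (Seq (NStore ''g'' (pair_index_exp ''i'' ''j'') (NConst 1))
      (Seq (NStore ''g'' (pair_index_exp ''j'' ''i'') (NConst 1))
      (Seq (NStore ''c'' (NVar ''i'') (NAdd (NArr ''c'' (NVar ''i'')) (NConst 1)))
      (Seq (NStore ''c'' (NVar ''j'') (NAdd (NArr ''c'' (NVar ''j'')) (NConst 1)))
           (NAssign ''e'' (NAdd (NVar ''e'') (NConst 1)))))))
      Skip"

lemma addC_simps [simp]:
  "loopfree addC" "nmods addC = {''e''}" "amods addC = {''g'', ''c''}" "rmods addC = {}"
  by (auto simp: addC_def)

definition buildC :: com where
  "buildC = For ''i'' (NVar ''N'') (For ''j'' (NVar ''N'') addC)"

lemma buildC_mods [simp]:
  "nmods buildC = {''i'', ''j'', ''e''}" "amods buildC = {''g'', ''c''}" "rmods buildC = {}"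
  by (auto simp: buildC_def)

lemma effect_addC:
  assumes v: "nvar s ''m'' = m" "nvar s ''N'' = Suc n" "nvar s ''i'' = i" "nvar s ''j'' = j" "narr s ''d'' = d"
    and ij: "i \<le> n" "j \<le> n"
    and E: "staircase_prefix n m d i j E" "represents n E (narr s ''g'') (narr s ''c'')" "nvar s ''e'' = card E"
  obtains E' where "staircase_prefix n m d i (Suc j) E'"
    "represents n E' (narr (effect addC s) ''g'') (narr (effect addC s) ''c'')" "nvar (effect addC s) ''e'' = card E'"
proof (cases "1 \<le> i \<and> i < j \<and> i \<le> d j \<and> card E < m")
  case True
  have Eq: "E = staircase n d i j" using E(1) True by (auto simp: staircase_prefix_def)
  have fin: "finite E" unfolding Eq by (rule simple_graph_finite[OF staircase_simple])
  have new: "{i, j} \<notin> E" using True by (simp add: Eq staircase_edge)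
  have "insert {i, j} E = staircase n d i (Suc j)" using True ij by (simp add: Eq staircase_step)
  then have "staircase_prefix n m d i (Suc j) (insert {i, j} E)"
    using True card_insert_disjoint[OF fin new] by (simp add: staircase_prefix_def)
  moreover have "represents n (insert {i, j} E) (narr (effect addC s) ''g'') (narr (effect addC s) ''c'')"
    using represents_insert[OF E(2) fin ij] True new v E(3) by (simp add: addC_def pair_index_exp_def not_less)
  moreover have "nvar (effect addC s) ''e'' = card (insert {i, j} E)"
    using True new fin v E(3) by (simp add: addC_def pair_index_exp_def not_less)
  ultimately show ?thesis by (rule that)
next
  case False
  have "effect addC s = s" using False v E(3) by (auto simp: addC_def)
  moreover have "staircase_prefix n m d i (Suc j) E"
  proof (cases "card E = m")
    case True
    then show ?thesis using E(1) by (auto simp: staircase_prefix_def)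
  next
    case neq: False
    then have "card E < m" using E(1) by (auto simp: staircase_prefix_def)
    then show ?thesis using E(1) False by (auto simp: staircase_prefix_def staircase_step)
  qed
  ultimately show ?thesis using E by (intro that[of E]) auto
qed

lemma runs_buildC:
  assumes n: "1 \<le> n" and v: "nvar s0 ''m'' = m" "nvar s0 ''N'' = Suc n" "nvar s0 ''e'' = 0"
    and d: "narr s0 ''d'' = d" and z: "narr s0 ''g'' = (\<lambda>_. 0)" "narr s0 ''c'' = (\<lambda>_. 0)"
    and eg: "erdos_gallai n m d"
  shows "runs buildC s0 (n ^ 2 * (3 * (3 * (max_time addC + 10) + 10))) (\<lambda>s. \<exists>i j.
    card (staircase n d i j) = m \<and> represents n (staircase n d i j) (narr s ''g'') (narr s ''c''))"
proof -
  define I where "I i j s \<longleftrightarrow> (\<exists>E. staircase_prefix n m d i j E \<and>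
    represents n E (narr s ''g'') (narr s ''c'') \<and> nvar s ''e'' = card E)" for i j and s :: state
  show ?thesis unfolding buildC_def
  proof (rule runs_For_vertices[where I = "\<lambda>i. I i 0" and e = 1 and K = "3 * (max_time addC + 10)"])
    have "staircase n d 0 0 = {}" by (auto simp: staircase_def)
    then show "I 0 0 (s0\<lparr>nvar := (nvar s0)(''i'' := 0)\<rparr>)"
      unfolding I_def using v z
      by (intro exI[of _ "{}"]) (simp add: staircase_prefix_def represents_def degree_def)
  next
    fix i s assume i: "i < Suc n" "I i 0 s" "nvar s ''i'' = i"
      and fr: "frame (For ''i'' (NVar ''N'') (For ''j'' (NVar ''N'') addC)) s0 s"
    show "runs (For ''j'' (NVar ''N'') addC) s (n ^ 1 * (3 * (max_time addC + 10)))
        (\<lambda>s'. I (Suc i) 0 (s'\<lparr>nvar := (nvar s')(''i'' := Suc i)\<rparr>))"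
    proof (rule runs_For_vertices[where I = "I i" and e = 0 and K = "max_time addC"])
      show "I i 0 (s\<lparr>nvar := (nvar s)(''j'' := 0)\<rparr>)" using i by (simp add: I_def)
    next
      fix j t assume j: "j < Suc n" "I i j t" "nvar t ''j'' = j"
        and fr': "frame (For ''j'' (NVar ''N'') addC) s t"
      have vt: "nvar t ''m'' = m" "nvar t ''N'' = Suc n" "nvar t ''i'' = i" "narr t ''d'' = d"
        using v d i fr fr' by (simp_all add: frame_def)
      obtain E where E: "staircase_prefix n m d i j E" "represents n E (narr t ''g'') (narr t ''c'')"
        "nvar t ''e'' = card E" using j(2) by (auto simp: I_def)
      obtain E' where "staircase_prefix n m d i (Suc j) E'"
        "represents n E' (narr (effect addC t) ''g'') (narr (effect addC t) ''c'')" "nvar (effect addC t) ''e'' = card E'"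
        using effect_addC[OF vt(1-3) j(3) vt(4) _ _ E] i j by auto
      then show "runs addC t (n ^ 0 * max_time addC) (\<lambda>s'. I i (Suc j) (s'\<lparr>nvar := (nvar s')(''j'' := Suc j)\<rparr>))"
        by (intro runs_loopfree) (auto simp: I_def)
    next
      show "nvar s ''N'' = Suc n" using v fr by (simp add: frame_def)
    next
      fix t assume "I i (Suc n) t"
      then show "I (Suc i) 0 (t\<lparr>nvar := (nvar t)(''i'' := Suc i)\<rparr>)"
        by (auto simp: I_def staircase_prefix_def staircase_row_end)
    qed (use n in auto)
  next
    fix s assume "I (Suc n) 0 s"
    then obtain E where E: "staircase_prefix n m d (Suc n) 0 E" "represents n E (narr s ''g'') (narr s ''c'')"
      by (auto simp: I_def)
    have "card E = m \<and> (\<exists>i j. E = staircase n d i j)"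
      using E(1) staircase_large[OF eg, of 0] by (auto simp: staircase_prefix_def)
    then show "\<exists>i j. card (staircase n d i j) = m \<and>
      represents n (staircase n d i j) (narr s ''g'') (narr s ''c'')" using E(2) by auto
  qed (use n v in \<open>auto simp: numeral_2_eq_2\<close>)
qed

definition moveC :: com where
  "moveC =
    If (BAnd (NLess (NVar ''i'') (NVar ''j''))
       (BAnd (NLess (NArr ''c'' (NVar ''j'')) (NArr ''d'' (NVar ''j'')))
       (BAnd (NLess (NArr ''d'' (NVar ''i'')) (NArr ''c'' (NVar ''i'')))
       (BAnd (NEq (NArr ''g'' (pair_index_exp ''i'' ''w'')) (NConst 1))
       (BAnd (BNot (NEq (NVar ''w'') (NVar ''j'')))
             (NEq (NArr ''g'' (pair_index_exp ''j'' ''w'')) (NConst 0)))))))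
      (Seq (NStore ''g'' (pair_index_exp ''i'' ''w'') (NConst 0))
      (Seq (NStore ''g'' (pair_index_exp ''w'' ''i'') (NConst 0))
      (Seq (NStore ''g'' (pair_index_exp ''j'' ''w'') (NConst 1))
      (Seq (NStore ''g'' (pair_index_exp ''w'' ''j'') (NConst 1))
      (Seq (NStore ''c'' (NVar ''i'') (NSub (NArr ''c'' (NVar ''i'')) (NConst 1)))
           (NStore ''c'' (NVar ''j'') (NAdd (NArr ''c'' (NVar ''j'')) (NConst 1))))))))
      Skip"

lemma moveC_simps [simp]:
  "loopfree moveC" "nmods moveC = {}" "amods moveC = {''g'', ''c''}" "rmods moveC = {}"
  by (auto simp: moveC_def)

definition transferC :: com where
  "transferC = For ''j'' (NVar ''N'') (For ''i'' (NVar ''N'') (For ''w'' (NVar ''N'') moveC))"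

lemma transferC_mods [simp]:
  "nmods transferC = {''i'', ''j'', ''w''}" "amods transferC = {''g'', ''c''}" "rmods transferC = {}"
  by (auto simp: transferC_def)

lemma effect_moveC:
  assumes v: "nvar s ''N'' = Suc n" "nvar s ''i'' = i" "nvar s ''j'' = j" "nvar s ''w'' = w" "narr s ''d'' = d"
    and ijw: "i \<le> n" "j \<le> n" "w \<le> n" and G: "simple_graph n E"
    and rep: "represents n E (narr s ''g'') (narr s ''c'')"
  shows "represents n (transfer_step d j i w E) (narr (effect moveC s) ''g'') (narr (effect moveC s) ''c'')"
proof (cases "i < j \<and> degree E j < d j \<and> d i < degree E i \<and> movable i j w E")
  case True
  have "narr s ''g'' (i * Suc n + w) = 1" "narr s ''g'' (j * Suc n + w) = 0"
    "narr s ''c'' i = degree E i" "narr s ''c'' j = degree E j" "w \<noteq> j"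
    using True rep ijw by (auto simp: represents_def movable_def simp del: mult_Suc_right)
  then show ?thesis
    using True v represents_move[OF rep G _ ijw(2) _ , of i w]
    by (simp add: moveC_def pair_index_exp_def transfer_step_def del: mult_Suc_right)
next
  case False
  have "\<not> bval (BAnd (NLess (NVar ''i'') (NVar ''j''))
       (BAnd (NLess (NArr ''c'' (NVar ''j'')) (NArr ''d'' (NVar ''j'')))
       (BAnd (NLess (NArr ''d'' (NVar ''i'')) (NArr ''c'' (NVar ''i'')))
       (BAnd (NEq (NArr ''g'' (pair_index_exp ''i'' ''w'')) (NConst 1))
       (BAnd (BNot (NEq (NVar ''w'') (NVar ''j'')))
             (NEq (NArr ''g'' (pair_index_exp ''j'' ''w'')) (NConst 0))))))) s"
    using False rep ijw v by (auto simp: represents_def movable_def pair_index_exp_def simp del: mult_Suc_right)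
  then have "effect moveC s = s" by (simp only: moveC_def effect.simps if_False)
  then show ?thesis using False rep by (auto simp: transfer_step_def)
qed

lemma runs_transferC:
  assumes n: "1 \<le> n" and v: "nvar s0 ''N'' = Suc n" and d: "narr s0 ''d'' = d" "erdos_gallai n m d"
    and rep: "represents n E0 (narr s0 ''g'') (narr s0 ''c'')" and col: "col_inv n m d 0 E0"
  shows "runs transferC s0 (n ^ 3 * (3 * (3 * (3 * (max_time moveC + 10) + 10) + 10))) (\<lambda>s. \<exists>E c.
    simple_graph n E \<and> card E = m \<and> (\<forall>i\<in>{1..n}. degree E i = d i) \<and> represents n E (narr s ''g'') c)"
proof -
  have mono: "nonincreasing n d" using d(2) by (simp add: erdos_gallai_def)
  define I where "I P s \<longleftrightarrow> (\<exists>E. P E \<and> represents n E (narr s ''g'') (narr s ''c''))" for P and s :: state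
  show ?thesis unfolding transferC_def
  proof (rule runs_For_vertices[where I = "\<lambda>j. I (col_inv n m d j)" and e = 2
        and K = "3 * (3 * (max_time moveC + 10) + 10)"])
    show "I (col_inv n m d 0) (s0\<lparr>nvar := (nvar s0)(''j'' := 0)\<rparr>)" using rep col by (auto simp: I_def)
  next
    fix j s1 assume j: "j < Suc n" "I (col_inv n m d j) s1" "nvar s1 ''j'' = j"
      and fr1: "frame (For ''j'' (NVar ''N'') (For ''i'' (NVar ''N'') (For ''w'' (NVar ''N'') moveC))) s0 s1"
    show "runs (For ''i'' (NVar ''N'') (For ''w'' (NVar ''N'') moveC)) s1 (n ^ 2 * (3 * (3 * (max_time moveC + 10) + 10)))
        (\<lambda>s'. I (col_inv n m d (Suc j)) (s'\<lparr>nvar := (nvar s')(''j'' := Suc j)\<rparr>))"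
    proof (rule runs_For_vertices[where I = "\<lambda>i. I (row_inv n m d j i)" and e = 1 and K = "3 * (max_time moveC + 10)"])
      show "I (row_inv n m d j 0) (s1\<lparr>nvar := (nvar s1)(''i'' := 0)\<rparr>)"
        using j by (auto simp: I_def row_inv_def)
    next
      fix i s2 assume i: "i < Suc n" "I (row_inv n m d j i) s2" "nvar s2 ''i'' = i"
        and fr2: "frame (For ''i'' (NVar ''N'') (For ''w'' (NVar ''N'') moveC)) s1 s2"
      show "runs (For ''w'' (NVar ''N'') moveC) s2 (n ^ 1 * (3 * (max_time moveC + 10)))
          (\<lambda>s'. I (row_inv n m d j (Suc i)) (s'\<lparr>nvar := (nvar s')(''i'' := Suc i)\<rparr>))"
      proof (rule runs_For_vertices[where I = "\<lambda>w. I (cell_inv n m d j i w)" and e = 0 and K = "max_time moveC"])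
        show "I (cell_inv n m d j i 0) (s2\<lparr>nvar := (nvar s2)(''w'' := 0)\<rparr>)"
          using i by (auto simp: I_def cell_inv_def)
      next
        fix w s3 assume w: "w < Suc n" "I (cell_inv n m d j i w) s3" "nvar s3 ''w'' = w"
          and fr3: "frame (For ''w'' (NVar ''N'') moveC) s2 s3"
        have vt: "nvar s3 ''N'' = Suc n" "nvar s3 ''i'' = i" "nvar s3 ''j'' = j" "narr s3 ''d'' = d"
          using v d i j fr1 fr2 fr3 by (simp_all add: frame_def)
        obtain E where E: "cell_inv n m d j i w E" "represents n E (narr s3 ''g'') (narr s3 ''c'')"
          using w(2) by (auto simp: I_def)
        have G: "simple_graph n E" using E(1) by (simp add: cell_inv_def row_inv_def col_inv_def)
        have "cell_inv n m d j i (Suc w) (transfer_step d j i w E)"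
          using j by (intro transfer_step_inv[OF E(1)]) simp
        moreover have "represents n (transfer_step d j i w E) (narr (effect moveC s3) ''g'') (narr (effect moveC s3) ''c'')"
          using i j w by (intro effect_moveC[OF vt(1-3) w(3) vt(4) _ _ _ G E(2)]) simp_all
        ultimately show "runs moveC s3 (n ^ 0 * max_time moveC)
            (\<lambda>s'. I (cell_inv n m d j i (Suc w)) (s'\<lparr>nvar := (nvar s')(''w'' := Suc w)\<rparr>))"
          by (intro runs_loopfree) (auto simp: I_def)
      next
        show "nvar s2 ''N'' = Suc n" using v fr1 fr2 by (simp add: frame_def)
      next
        fix t assume "I (cell_inv n m d j i (Suc n)) t"
        then show "I (row_inv n m d j (Suc i)) (t\<lparr>nvar := (nvar t)(''i'' := Suc i)\<rparr>)"
          using transfer_row_end[OF mono, of m j i] j(1) unfolding I_def by auto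
      qed (use n in auto)
    next
      show "nvar s1 ''N'' = Suc n" using v fr1 by (simp add: frame_def)
    next
      fix t assume "I (row_inv n m d j (Suc n)) t"
      then show "I (col_inv n m d (Suc j)) (t\<lparr>nvar := (nvar t)(''j'' := Suc j)\<rparr>)"
        using transfer_col_end[of n m d j] j(1) unfolding I_def by auto
    qed (use n in \<open>auto simp: numeral_2_eq_2\<close>)
  next
    fix s assume "I (col_inv n m d (Suc n)) s"
    then obtain E where E: "col_inv n m d (Suc n) E" "represents n E (narr s ''g'') (narr s ''c'')"
      by (auto simp: I_def)
    show "\<exists>E c. simple_graph n E \<and> card E = m \<and> (\<forall>i\<in>{1..n}. degree E i = d i) \<and> represents n E (narr s ''g'') c"
      using transfer_end[OF d(2) E(1)] E(2) by blast
  qed (use n v in auto)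
qed

section \<open>Writing the edge list\<close>

definition emitC :: com where
  "emitC =
    If (BAnd (NLess (NVar ''i'') (NVar ''j'')) (NEq (NArr ''g'' (pair_index_exp ''i'' ''j'')) (NConst 1)))
      (Seq (NStore ''u'' (NVar ''e'') (NVar ''i''))
      (Seq (NStore ''v'' (NVar ''e'') (NVar ''j''))
           (NAssign ''e'' (NAdd (NVar ''e'') (NConst 1)))))
      Skip"

lemma emitC_simps [simp]:
  "loopfree emitC" "nmods emitC = {''e''}" "amods emitC = {''u'', ''v''}" "rmods emitC = {}"
  by (auto simp: emitC_def)

definition outputC :: com where
  "outputC = For ''i'' (NVar ''N'') (For ''j'' (NVar ''N'') emitC)"

definition edges_before :: "nat set set \<Rightarrow> nat \<Rightarrow> nat \<Rightarrow> nat set set" where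
  "edges_before E i j = {{x, y} |x y. x < y \<and> {x, y} \<in> E \<and> (x < i \<or> x = i \<and> y < j)}"

lemma edges_before_step:
  "edges_before E i (Suc j) =
    (if i < j \<and> {i, j} \<in> E then insert {i, j} (edges_before E i j) else edges_before E i j)"
proof -
  have "edges_before E i (Suc j) =
      edges_before E i j \<union> {{x, y} |x y. x = i \<and> y = j \<and> x < y \<and> {x, y} \<in> E}"
    unfolding edges_before_def less_Suc_eq by blast
  then show ?thesis by auto
qed

lemma edges_before_new: "i < j \<Longrightarrow> {i, j} \<notin> edges_before E i j"
  by (auto simp: edges_before_def doubleton_eq_iff)

lemma edges_before_row_end:
  assumes "simple_graph n E" shows "edges_before E i (Suc n) = edges_before E (Suc i) 0"
proof -
  have "y < Suc n" if "{x, y} \<in> E" for x y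
    using simple_graph_edge(5)[OF assms that] by simp
  then show ?thesis
    unfolding edges_before_def by (intro Collect_cong iff_exI conj_cong refl) auto
qed

lemma edges_before_end:
  assumes "simple_graph n E" shows "edges_before E (Suc n) 0 = E"
proof
  show "E \<subseteq> edges_before E (Suc n) 0"
  proof
    fix e assume e: "e \<in> E"
    then obtain x y where "e = {x, y}" "x < y" "1 \<le> x" "y \<le> n" using simple_graph_edge_ex[OF assms] by blast
    then show "e \<in> edges_before E (Suc n) 0"
      using e unfolding edges_before_def by (intro CollectI exI[of _ x] exI[of _ y]) auto
  qed
qed (auto simp: edges_before_def)

lemma output_graph_Suc:
  "output_graph (Suc m) s = insert {narr s ''u'' m, narr s ''v'' m} (output_graph m s)"
  by (auto simp: output_graph_def less_Suc_eq)

lemma output_graph_cong: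
  assumes "\<And>k. k < m \<Longrightarrow> narr s ''u'' k = narr t ''u'' k \<and> narr s ''v'' k = narr t ''v'' k"
  shows "output_graph m s = output_graph m t"
proof -
  have "e = {narr s ''u'' k, narr s ''v'' k} \<and> k < m \<longleftrightarrow> e = {narr t ''u'' k, narr t ''v'' k} \<and> k < m" for e k
    by (cases "k < m") (simp_all add: assms)
  then show ?thesis by (simp only: output_graph_def)
qed

lemma runs_outputC:
  assumes n: "1 \<le> n" and v: "nvar s0 ''N'' = Suc n" "nvar s0 ''e'' = 0"
    and G: "simple_graph n E" "card E = m" and rep: "represents n E (narr s0 ''g'') c"
  shows "runs outputC s0 (n ^ 2 * (3 * (3 * (max_time emitC + 10) + 10))) (\<lambda>s. output_graph m s = E)"
proof -
  define I where "I i j s \<longleftrightarrow> nvar s ''e'' = card (edges_before E i j) \<and>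
    output_graph (nvar s ''e'') s = edges_before E i j" for i j and s :: state
  have fin: "finite (edges_before E i j)" for i j
    by (rule finite_subset[OF _ simple_graph_finite[OF G(1)]]) (auto simp: edges_before_def)
  have I_upd: "I i j (s\<lparr>nvar := (nvar s)(x := k)\<rparr>) = I i j s" if "x \<noteq> ''e''" for i j s x k
    using that by (simp add: I_def output_graph_def)
  show ?thesis unfolding outputC_def
  proof (rule runs_For_vertices[where I = "\<lambda>i. I i 0" and e = 1 and K = "3 * (max_time emitC + 10)"])
    have "edges_before E 0 0 = {}" by (auto simp: edges_before_def)
    then show "I 0 0 (s0\<lparr>nvar := (nvar s0)(''i'' := 0)\<rparr>)"
      using v by (auto simp: I_def output_graph_def)
  next
    fix i s assume i: "i < Suc n" "I i 0 s" "nvar s ''i'' = i"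
      and fr: "frame (For ''i'' (NVar ''N'') (For ''j'' (NVar ''N'') emitC)) s0 s"
    show "runs (For ''j'' (NVar ''N'') emitC) s (n ^ 1 * (3 * (max_time emitC + 10)))
        (\<lambda>s'. I (Suc i) 0 (s'\<lparr>nvar := (nvar s')(''i'' := Suc i)\<rparr>))"
    proof (rule runs_For_vertices[where I = "I i" and e = 0 and K = "max_time emitC"])
      show "I i 0 (s\<lparr>nvar := (nvar s)(''j'' := 0)\<rparr>)" using i(2) by (simp add: I_upd)
    next
      fix j t assume j: "j < Suc n" "I i j t" "nvar t ''j'' = j"
        and fr': "frame (For ''j'' (NVar ''N'') emitC) s t"
      have vt: "nvar t ''N'' = Suc n" "nvar t ''i'' = i" "narr t ''g'' = narr s0 ''g''"
        using v i fr fr' by (simp_all add: frame_def)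
      have g: "narr t ''g'' (i * Suc n + j) = of_bool ({i, j} \<in> E)"
        unfolding vt(3) using rep i(1) j(1) unfolding represents_def less_Suc_eq_le by blast
      have "I i (Suc j) (effect emitC t)"
      proof (cases "i < j \<and> {i, j} \<in> E")
        case True
        let ?e = "nvar t ''e''" and ?t = "effect emitC t"
        have t': "?t = t\<lparr>narr := (narr t)(''u'' := (narr t ''u'')(?e := i), ''v'' := (narr t ''v'')(?e := j)),
            nvar := (nvar t)(''e'' := Suc ?e)\<rparr>"
          using True g vt j by (simp add: emitC_def pair_index_exp_def)
        have before: "?e = card (edges_before E i j)" "output_graph ?e t = edges_before E i j"
          using j(2) unfolding I_def by blast+
        have uv: "narr ?t ''u'' ?e = i" "narr ?t ''v'' ?e = j" by (simp_all add: t')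
        have "output_graph ?e ?t = output_graph ?e t" unfolding t' by (rule output_graph_cong) simp
        then have after: "output_graph (Suc ?e) ?t = insert {i, j} (edges_before E i j)"
          unfolding output_graph_Suc uv before(2) by (simp only:)
        have "nvar ?t ''e'' = Suc ?e" by (simp add: t')
        moreover have "Suc ?e = card (insert {i, j} (edges_before E i j))"
          using card_insert_disjoint[OF fin edges_before_new[of i j E]] True before(1) by simp
        ultimately show ?thesis
          using True after unfolding I_def edges_before_step by simp
      next
        case False
        then have same: "effect emitC t = t" using g vt j by (cases "i < j") (simp_all add: emitC_def pair_index_exp_def)
        have "edges_before E i (Suc j) = edges_before E i j"
          unfolding edges_before_step using False by (rule if_not_P)
        then show ?thesis using j(2) unfolding I_def same by metis
      qed
      then show "runs emitC t (n ^ 0 * max_time emitC) (\<lambda>s'. I i (Suc j) (s'\<lparr>nvar := (nvar s')(''j'' := Suc j)\<rparr>))"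
        by (intro runs_loopfree) (simp_all add: I_upd)
    next
      show "nvar s ''N'' = Suc n" using v fr by (simp add: frame_def)
    next
      fix t assume "I i (Suc n) t"
      then have "I (Suc i) 0 t" unfolding I_def edges_before_row_end[OF G(1)] .
      then show "I (Suc i) 0 (t\<lparr>nvar := (nvar t)(''i'' := Suc i)\<rparr>)" by (simp add: I_upd)
    qed (use n in auto)
  next
    fix s assume "I (Suc n) 0 s"
    then show "output_graph m s = E" using G by (auto simp: I_def edges_before_end)
  qed (use n v in \<open>auto simp: numeral_2_eq_2\<close>)
qed

section \<open>The whole algorithm\<close>

text \<open>
  Some graph with \<open>m\<close> edges exists, and its sorted degree sequence is a completion of the initial state.
\<close>

lemma best_feasible:
  assumes "m \<le> n choose 2" shows "fst (best m f 0 n n 0 0) \<noteq> 0"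
proof -
  have "card {e. e \<subseteq> {1..n} \<and> card e = 2} = n choose 2" using n_subsets[of "{1..n}" 2] by simp
  then have "m \<le> card {e. e \<subseteq> {1..n} \<and> card e = 2}" using assms by simp
  then obtain E where E: "E \<subseteq> {e. e \<subseteq> {1..n} \<and> card e = 2}" "card E = m"
    by (rule obtain_subset_with_card_n)
  then have "simple_graph n E" by (auto simp: simple_graph_def)
  then obtain d where "erdos_gallai n m d" using E(2) by (rule graph_erdos_gallai)
  then have "completion m 0 n n 0 0 d" by (rule erdos_gallai_completion)
  then show ?thesis using best_upper by (fastforce simp: attains_def)
qed

text \<open>
  The table works with \<open>g\<close>, which agrees with \<open>f\<close> only up to \<open>m\<close>. This is enough for comparing graphs,
  as no degree exceeds the number of edges.
\<close>

lemma best_optimal: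
  assumes E: "simple_graph n E" "card E = m" "\<And>i. i \<in> {1..n} \<Longrightarrow> degree E i = d i"
    and d: "(\<Sum>i\<in>{0<..n}. g (d i)) = snd (best m g 0 n n 0 0)"
    and g: "\<And>t. t \<le> m \<Longrightarrow> g t = f t"
  shows "optimal_graph n m f E"
proof -
  have obj: "objective n f E' = objective n g E'" if "simple_graph n E'" "card E' = m" for E'
    unfolding objective_def
    using degree_le_card[OF simple_graph_finite[OF that(1)]] that(2) by (intro sum.cong) (auto simp: g)
  have range: "{1..n} = {0<..n}" by auto
  have "objective n f E' \<le> objective n f E" if G: "simple_graph n E'" "card E' = m" for E'
  proof -
    obtain d' where d': "erdos_gallai n m d'" "\<And>f. objective n f E' = (\<Sum>i=1..n. f (d' i))"
      by (rule graph_erdos_gallai[OF G]) blast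
    have "objective n g E' \<le> snd (best m g 0 n n 0 0)"
      using best_upper[OF erdos_gallai_completion[OF d'(1)], of g] unfolding d'(2) range
      by (simp add: attains_def)
    also have "\<dots> = objective n g E"
      unfolding objective_def d[symmetric] range[symmetric] using E(3) by simp
    finally show ?thesis using obj[OF G] obj[OF E(1,2)] by simp
  qed
  then show ?thesis using E by (simp add: optimal_graph_def)
qed

definition initC :: com where
  "initC = Seq (NAssign ''N'' (NAdd (NVar ''n'') (NConst 1)))
    (NAssign ''M'' (NAdd (NMul (NConst 2) (NVar ''m'')) (NConst 1)))"

definition startC :: com where
  "startC = Seq (NAssign ''h'' (NVar ''n'')) (Seq (NAssign ''a'' (NVar ''n'')) (Seq (NAssign ''b'' (NVar ''n''))
    (Seq (NAssign ''p'' (NConst 0)) (NAssign ''q'' (NConst 0)))))"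

definition optimizeC :: com where
  "optimizeC = Seq initC (Seq tableC (Seq startC (Seq walkC (Seq buildC (Seq transferC
    (Seq (NAssign ''e'' (NConst 0)) outputC))))))"

text \<open>
  The cells that building the graph expects to be zero and that the earlier phases leave alone.
\<close>

definition clean :: "state \<Rightarrow> bool" where
  "clean s \<longleftrightarrow> narr s ''g'' = (\<lambda>_. 0) \<and> narr s ''c'' = (\<lambda>_. 0) \<and> nvar s ''e'' = 0"

text \<open>
  The phases are composed from the last one backwards, each frame carrying the facts that the later phases need.
\<close>

lemma runs_optimizeC:
  fixes f :: "nat \<Rightarrow> real"
  assumes n: "1 \<le> n" and m: "m \<le> n choose 2"
  defines "K \<equiv> 3 + ncost current_index_exp + 1 + max_time stepC + 1"
  assumes T: "max_time initC + ((Suc n * Suc n * Suc n * (Suc (2 * m) * Suc (2 * m)) + 1) * (max_time cellC + max_time odometerC + 9 + 9)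
    + (max_time startC + ((3 * n + 1) * K + (n ^ 2 * (3 * (3 * (max_time addC + 10) + 10))
    + (n ^ 3 * (3 * (3 * (3 * (max_time moveC + 10) + 10) + 10))
    + (2 + n ^ 2 * (3 * (3 * (max_time emitC + 10) + 10)))))))) \<le> T"
  shows "runs optimizeC (input_state n m f) T (\<lambda>s. optimal_graph n m f (output_graph m s))"
proof -
  let ?Q = "\<lambda>s. optimal_graph n m f (output_graph m s)"
  define g where "g t = (if t \<le> m then f t else 0)" for t
  let ?c6 = "Seq (NAssign ''e'' (NConst 0)) outputC"
  let ?T6 = "2 + n ^ 2 * (3 * (3 * (max_time emitC + 10) + 10))"
  let ?T5 = "n ^ 3 * (3 * (3 * (3 * (max_time moveC + 10) + 10) + 10)) + ?T6"
  let ?T4 = "n ^ 2 * (3 * (3 * (max_time addC + 10) + 10)) + ?T5"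
  let ?T3 = "(3 * n + 1) * K + ?T4"
  let ?T2 = "max_time startC + ?T3"
  have emit: "runs ?c6 s ?T6 ?Q"
    if s: "nvar s ''N'' = Suc n" and G: "simple_graph n E" "card E = m" "\<forall>i\<in>{1..n}. degree E i = d i"
      and rep: "represents n E (narr s ''g'') c"
      and d: "(\<Sum>i\<in>{0<..n}. g (d i)) = snd (best m g 0 n n 0 0)" for s E d c
  proof (rule runs_Seq[OF runs_loopfree order_refl])
    let ?s = "effect (NAssign ''e'' (NConst 0)) s"
    have "runs outputC ?s (n ^ 2 * (3 * (3 * (max_time emitC + 10) + 10))) (\<lambda>s. output_graph m s = E)"
      using s rep by (intro runs_outputC[OF n _ _ G(1,2)]) simp_all
    moreover have "optimal_graph n m f E"
      using G d by (intro best_optimal[OF G(1,2), of d g]) (simp_all add: g_def)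
    ultimately show "runs outputC ?s (n ^ 2 * (3 * (3 * (max_time emitC + 10) + 10))) ?Q"
      by (auto elim: runs_weaken)
  qed simp_all
  have graph: "runs (Seq buildC (Seq transferC ?c6)) s ?T4 ?Q"
    if s: "instance_state n m g s" "clean s" and eg: "erdos_gallai n m (narr s ''d'')"
      and d: "(\<Sum>i\<in>{0<..n}. g (narr s ''d'' i)) = snd (best m g 0 n n 0 0)" for s
  proof (rule runs_Seq[OF runs_weaken[OF runs_frame[OF runs_buildC[OF n _ _ _ refl _ _ eg]] order_refl] order_refl])
    fix t assume t: "(\<exists>i j. card (staircase n (narr s ''d'') i j) = m \<and>
      represents n (staircase n (narr s ''d'') i j) (narr t ''g'') (narr t ''c'')) \<and> frame buildC s t"
    then obtain i j where card: "card (staircase n (narr s ''d'') i j) = m"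
      and rep: "represents n (staircase n (narr s ''d'') i j) (narr t ''g'') (narr t ''c'')" by blast
    have tN: "nvar t ''N'' = Suc n" "narr t ''d'' = narr s ''d''"
      using t s by (simp_all add: frame_def instance_state_def)
    show "runs (Seq transferC ?c6) t ?T5 ?Q"
    proof (rule runs_Seq[OF runs_weaken[OF runs_frame[OF runs_transferC[OF n tN eg rep]] order_refl] order_refl])
      show "col_inv n m (narr s ''d'') 0 (staircase n (narr s ''d'') i j)"
        by (rule transfer_start[OF eg card])
    next
      fix u assume u: "(\<exists>E c. simple_graph n E \<and> card E = m \<and> (\<forall>i\<in>{1..n}. degree E i = narr s ''d'' i) \<and>
        represents n E (narr u ''g'') c) \<and> frame transferC t u"
      then have "nvar u ''N'' = Suc n" using tN by (simp add: frame_def)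
      then show "runs ?c6 u ?T6 ?Q" using u emit[OF _ _ _ _ _ d] by blast
    qed
  qed (use s in \<open>simp_all add: instance_state_def clean_def\<close>)
  have walk: "runs (Seq startC (Seq walkC (Seq buildC (Seq transferC ?c6)))) s ?T2 ?Q"
    if s: "instance_state n m g s" "clean s"
      and tab: "table_upto n m g (Suc n * Suc n * Suc n * (Suc (2 * m) * Suc (2 * m))) s" for s
  proof (rule runs_Seq[OF runs_loopfree order_refl])
    let ?s = "effect startC s"
    have s': "instance_state n m g ?s" "at_digits n n n 0 0 ?s" "clean ?s" "narr ?s = narr s"
      using s by (simp_all add: startC_def instance_state_def at_digits_def clean_def)
    have "runs walkC ?s ((n - (n - n) + n + n + 1) * K) (\<lambda>s'.
      completion m (n - n) n n 0 0 (narr s' ''d'') \<and>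
      (\<Sum>i\<in>{n - n<..n}. g (narr s' ''d'' i)) = snd (best m g (n - n) n n 0 0) \<and>
      (\<forall>i. i \<le> n - n \<or> n < i \<longrightarrow> narr s' ''d'' i = narr ?s ''d'' i))"
      unfolding K_def
    proof (rule runs_walkC[OF s'(1,2)])
      show "fst (best m g (n - n) n n 0 0) \<noteq> 0" using best_feasible[OF m] by simp
    qed (use s'(4) table_full[OF tab] in simp_all)
    then have "runs walkC ?s ((3 * n + 1) * K) (\<lambda>s'. (completion m 0 n n 0 0 (narr s' ''d'') \<and>
      (\<Sum>i\<in>{0<..n}. g (narr s' ''d'' i)) = snd (best m g 0 n n 0 0)) \<and> frame walkC ?s s')"
      by (intro runs_frame, elim runs_weaken) simp_all
    then have "runs walkC ?s ((3 * n + 1) * K) (\<lambda>s'. runs (Seq buildC (Seq transferC ?c6)) s' ?T4 ?Q)"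
    proof (rule runs_weaken[OF _ order_refl])
      fix t assume t: "(completion m 0 n n 0 0 (narr t ''d'') \<and>
        (\<Sum>i\<in>{0<..n}. g (narr t ''d'' i)) = snd (best m g 0 n n 0 0)) \<and> frame walkC ?s t"
      show "runs (Seq buildC (Seq transferC ?c6)) t ?T4 ?Q"
      proof (rule graph)
        show "erdos_gallai n m (narr t ''d'')" using t completion_erdos_gallai by blast
        show "(\<Sum>i\<in>{0<..n}. g (narr t ''d'' i)) = snd (best m g 0 n n 0 0)" using t by blast
      qed (use s' t in \<open>simp_all add: instance_state_def clean_def frame_def\<close>)
    qed
    then show "runs (Seq walkC (Seq buildC (Seq transferC ?c6))) ?s ?T3 ?Q"
      by (rule runs_Seq) (rule order_refl)
  qed (simp_all add: startC_def)
  show ?thesis unfolding optimizeC_def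
  proof (rule runs_Seq[OF runs_loopfree T])
    let ?s = "effect initC (input_state n m f)"
    have s: "instance_state n m g ?s" "at_digits 0 0 0 0 0 ?s" "clean ?s"
      by (simp_all add: initC_def input_state_def instance_state_def at_digits_def clean_def g_def[abs_def])
    show "runs (Seq tableC (Seq startC (Seq walkC (Seq buildC (Seq transferC ?c6))))) ?s
      ((Suc n * Suc n * Suc n * (Suc (2 * m) * Suc (2 * m)) + 1) * (max_time cellC + max_time odometerC + 9 + 9) + ?T2) ?Q"
    proof (rule runs_Seq[OF runs_weaken[OF runs_frame[OF runs_tableC[OF s(1,2) order_refl]] order_refl] order_refl])
      fix t assume t: "table_upto n m g (Suc n * Suc n * Suc n * (Suc (2 * m) * Suc (2 * m))) t \<and> frame tableC ?s t"
      show "runs (Seq startC (Seq walkC (Seq buildC (Seq transferC ?c6)))) t ?T2 ?Q"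
      proof (rule walk)
        have fr: "frame tableC ?s t" using t by blast
        show "instance_state n m g t" "clean t"
          using s(1,3) fr by (simp_all only: instance_state_def clean_def frame_def) simp_all
        show "table_upto n m g (Suc n * Suc n * Suc n * (Suc (2 * m) * Suc (2 * m))) t" using t by blast
      qed
    qed
  qed (simp_all add: initC_def)
qed

text \<open>
  The table has at most \<open>(2 * n) ^ 3 * (3 * m) ^ 2 = 72 * n ^ 3 * m ^ 2\<close> cells, and the other
  phases take \<open>O(n ^ 3)\<close> time. Both are within \<open>O(n ^ 5 * m ^ 2)\<close>.
\<close>

lemma time_bound:
  fixes n m :: nat
  assumes n: "1 \<le> n" and m: "1 \<le> m"
  shows "A + ((Suc n * Suc n * Suc n * (Suc (2 * m) * Suc (2 * m)) + 1) * B
      + (C + ((3 * n + 1) * D + (n ^ 2 * E + (n ^ 3 * F + (2 + n ^ 2 * G))))))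
    \<le> (A + 73 * B + C + 4 * D + E + F + 2 + G) * (n ^ 5 * m ^ 2)"
proof -
  let ?X = "n ^ 5 * m ^ 2"
  have m2: "1 \<le> m ^ 2" using m by simp
  have pow: "n ^ e \<le> ?X" if "e \<le> 5" for e
    using mult_le_mono[OF power_increasing[OF that n] m2] by simp
  have one: "1 \<le> ?X" using pow[of 0] by simp
  have "Suc n * Suc n * Suc n * (Suc (2 * m) * Suc (2 * m)) \<le> (2 * n) * (2 * n) * (2 * n) * ((3 * m) * (3 * m))"
    using n m by (intro mult_le_mono) linarith+
  also have "\<dots> = 72 * (n ^ 3 * m ^ 2)" by (simp add: power2_eq_square power3_eq_cube)
  also have "\<dots> \<le> 72 * ?X" using n by (intro mult_le_mono order_refl power_increasing) auto
  finally have cells: "Suc n * Suc n * Suc n * (Suc (2 * m) * Suc (2 * m)) + 1 \<le> 73 * ?X" using one by linarith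
  have walk: "3 * n + 1 \<le> 4 * ?X" using pow[of 1] n by (simp only: power_one_right) linarith
  have "A + ((Suc n * Suc n * Suc n * (Suc (2 * m) * Suc (2 * m)) + 1) * B
      + (C + ((3 * n + 1) * D + (n ^ 2 * E + (n ^ 3 * F + (2 + n ^ 2 * G))))))
    \<le> A * ?X + (73 * ?X * B + (C * ?X + (4 * ?X * D + (?X * E + (?X * F + (2 * ?X + ?X * G))))))"
    using one pow[of 2] pow[of 3] by (intro add_mono mult_le_mono1 cells walk) simp_all
  also have "\<dots> = (A + 73 * B + C + 4 * D + E + F + 2 + G) * ?X" by (simp only: algebra_simps)
  finally show ?thesis .
qed

theorem theorem1p2:
  "\<exists>(P :: com) (C :: nat). \<forall>(n :: nat) (m :: nat) (f :: nat \<Rightarrow> real).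
     1 \<le> n \<and> 1 \<le> m \<and> m \<le> n choose 2 \<longrightarrow>
     (\<exists>t s. exec P (input_state n m f) t s \<and> t \<le> C * (n ^ 5 * m ^ 2) \<and>
            optimal_graph n m f (output_graph m s))"
  using runs_optimizeC[OF _ _ time_bound] unfolding runs_def by blast

end
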